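(* Let $a_3(n)$ be defined by $\sum_{n\geq 0}a_3(n)q^n=\frac{f_3f_6}{f_1f_2}$, where $f_k=\prod_{m\geq1}(1-q^{km})$. Define integers $m_{i,j}$ for $i,j\geq 1$ as follows: $m_{i,j}=0$ whenever $j>i$; $m_{1,1}=3$; $m_{2,1}=2$, $m_{2,2}=3^3$; $m_{3,1}=1$, $m_{3,2}=3^3$, $m_{3,3}=3^5$; and for $i\geq 4$, $m_{i,1}=0$ and for $j\geq 2$, \[m_{i,j}=9m_{i-1,j-1}+3m_{i-2,j-1}+m_{i-3,j-1}.\] Define infinite matrices $A=(a_{i,j})_{i,j\geq1}$ and $B=(b_{i,j})_{i,j\geq1}$ by $a_{i,j}=m_{4i-3,\,i+j-1}$ and $b_{i,j}=m_{4i-1,\,i+j-1}$. Define row vectors $\mathbf{x}_\alpha=(x_{\alpha,1},x_{\alpha,2},\dots)$ by $\mathbf{x}_0=(1,0,0,\dots)$, $\mathbf{x}_{\alpha+1}=\mathbf{x}_\alpha A$ if $\alpha$ is even, and $\mathbf{x}_{\alpha+1}=\mathbf{x}_\alpha B$ if $\alpha$ is odd. Then for each $\alpha\geq 0$, \[\sum_{n\geq0}a_3\left(3^{2\alpha}n+\frac{3^{2\alpha}-1}{4}\right)q^n=\sum_{i\geq1}x_{2\alpha,i}\,q^{i-1}\left(\frac{f_3f_6}{f_1f_2}\right)^{4i-3}\] and \[\sum_{n\geq0}a_3\left(3^{2\alpha+1}n+\frac{3^{2\alpha+2}-1}{4}\right)q^n=\sum_{i\geq1}x_{2\alpha+1,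i}\,q^{i-1}\left(\frac{f_3f_6}{f_1f_2}\right)^{4i-1}.\]
   Context: $a_3(n)$ counts 3-regular cubic partitions of $n$. The vector-matrix products $\mathbf{x}_\alpha A$, $\mathbf{x}_\alpha B$ are finite sums since each $\mathbf{x}_\alpha$ has finitely many nonzero entries. *)

theory Defs
  imports "HOL-Computational_Algebra.Formal_Power_Series"
begin

text \<open>The infinite product f_k = prod_{m>=1} (1 - q^(k m)) as a formal power series:
  for k >= 1 the n-th coefficient is already determined by the factors with m <= n.\<close>
definition fprod :: "nat \<Rightarrow> rat fps" where
  "fprod k = Abs_fps (\<lambda>n. fps_nth (\<Prod>m\<in>{1..n}. (1 - fps_X ^ (k * m))) n)"

definition G :: "rat fps" where
  "G = fprod 3 * fprod 6 * inverse (fprod 1 * fprod 2)"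

definition a3 :: "nat \<Rightarrow> rat" where
  "a3 n = fps_nth G n"

function mm :: "nat \<Rightarrow> nat \<Rightarrow> int" where
  "mm i j = (if i = 0 \<or> j = 0 \<or> j > i then 0
     else if i = 1 then 3
     else if i = 2 then (if j = 1 then 2 else 3^3)
     else if i = 3 then (if j = 1 then 1 else if j = 2 then 3^3 else 3^5)
     else if j = 1 then 0
     else 9 * mm (i - 1) (j - 1) + 3 * mm (i - 2) (j - 1) + mm (i - 3) (j - 1))"
  by pat_completeness auto
termination by (relation "measure fst") auto

definition matA :: "nat \<Rightarrow> nat \<Rightarrow> int" where
  "matA i j = mm (4 * i - 3) (i + j - 1)"

definition matB :: "nat \<Rightarrow> nat \<Rightarrow> int" where
  "matB i j = mm (4 * i - 1) (i + j - 1)"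

text \<open>Row vector (indexed from 1) times infinite matrix; the sum is over the (finite)
  support of the vector.\<close>
definition vecmat :: "(nat \<Rightarrow> int) \<Rightarrow> (nat \<Rightarrow> nat \<Rightarrow> int) \<Rightarrow> nat \<Rightarrow> int" where
  "vecmat x M = (\<lambda>j. if j = 0 then 0 else (\<Sum>i | 1 \<le> i \<and> x i \<noteq> 0. x i * M i j))"

primrec xv :: "nat \<Rightarrow> nat \<Rightarrow> int" where
  "xv 0 = (\<lambda>j. if j = 1 then 1 else 0)"
| "xv (Suc a) = vecmat (xv a) (if even a then matA else matB)"

end

theory Submission
  imports Defs
begin

text \<open>
  Jacobi's triple product gives \<open>f_1 f_2 = f_9 f_18 (\<alpha>(q^3) - q + q^2 \<gamma>(q^3))\<close> with
  \<open>\<alpha> \<gamma> = -2\<close>, as \<open>f_1 f_2 = \<phi>(-q) \<psi>(q)\<close> and each of the two theta functions has a simple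
  3-dissection. Multiplying the series \<open>f_1 f_2\<close> at \<open>q\<close>, \<open>\<omega>q\<close>, \<open>\<omega>^2q\<close> for a primitive cube root
  of unity \<open>\<omega>\<close> gives \<open>f_3^4 f_6^4 / (f_9 f_18)\<close>. Hence \<open>\<zeta> = q f_9 f_18 / (f_1 f_2)\<close> satisfies
  \<open>\<zeta>^3 = Y(q^3) (1 + 3 \<zeta> + 9 \<zeta>^2)\<close> with \<open>Y = q G^4\<close>, and this recurrence shows that the part of
  \<open>\<zeta>^i\<close> with exponents divisible by 3 is \<open>\<Sum>j. m_{i,j} Y(q^3)^j\<close>. Since \<open>\<zeta> = q G(q) G(q^3)\<close>,
  extracting every third coefficient of \<open>q^(i-1) G^(4i-3)\<close> or \<open>q^(i-1) G^(4i-1)\<close> amounts to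
  this, and produces the rows of the matrices \<open>A\<close> and \<open>B\<close>.
\<close>

section \<open>Congruence of power series and infinite products\<close>

text \<open>Congruence modulo \<open>fps_X ^ N\<close>. Infinite products and theta series are
  handled through finite truncations that agree with them in this sense for each
  \<open>N\<close>.\<close>

definition cong_upto :: "nat \<Rightarrow> 'a::comm_ring_1 fps \<Rightarrow> 'a fps \<Rightarrow> bool" where
  "cong_upto N f g \<longleftrightarrow> (\<forall>i<N. fps_nth f i = fps_nth g i)"

lemma cong_upto_refl [simp]: "cong_upto N f f"
  by (simp add: cong_upto_def)

lemma cong_upto_sym: "cong_upto N f g \<Longrightarrow> cong_upto N g f"
  by (simp add: cong_upto_def)

lemma cong_upto_trans [trans]: "cong_upto N f g \<Longrightarrow> cong_upto N g h \<Longrightarrow> cong_upto N f h"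
  by (simp add: cong_upto_def)

lemma cong_upto_add: "cong_upto N f g \<Longrightarrow> cong_upto N f' g' \<Longrightarrow> cong_upto N (f + f') (g + g')"
  by (simp add: cong_upto_def)

lemma cong_upto_mult:
  assumes "cong_upto N f g" "cong_upto N f' g'"
  shows "cong_upto N (f * f') (g * g')"
  unfolding cong_upto_def
proof (intro allI impI)
  fix i assume "i < N"
  then show "fps_nth (f * f') i = fps_nth (g * g') i"
    using assms by (auto simp: cong_upto_def fps_mult_nth intro!: sum.cong)
qed

lemma cong_upto_power: "cong_upto N f g \<Longrightarrow> cong_upto N (f ^ n) (g ^ n)"
  by (induction n) (auto intro: cong_upto_mult)

lemma cong_upto_sum:
  "(\<And>x. x \<in> S \<Longrightarrow> cong_upto N (f x) (g x)) \<Longrightarrow> cong_upto N (sum f S) (sum g S)"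
  by (simp add: cong_upto_def fps_sum_nth)

lemma cong_upto_X_power_mult_0: "N \<le> M \<Longrightarrow> cong_upto N (fps_X ^ M * f) 0"
  by (simp add: cong_upto_def fps_X_power_mult_nth)

text \<open>Multiply the congruence by \<open>inverse f * inverse g\<close>; one factor cancels on
  each side because the constant terms are nonzero.\<close>

lemma cong_upto_inverse:
  fixes f g :: "'a::field fps"
  assumes "cong_upto N f g" "fps_nth f 0 \<noteq> 0" "fps_nth g 0 \<noteq> 0"
  shows "cong_upto N (inverse f) (inverse g)"
proof -
  have "cong_upto N (inverse f * inverse g * g) (inverse f * inverse g * f)"
    by (intro cong_upto_mult cong_upto_refl cong_upto_sym[OF assms(1)])
  moreover have "inverse f * inverse g * g = inverse f" "inverse f * inverse g * f = inverse g"
    using assms(2,3) by (simp_all add: mult.assoc inverse_mult_eq_1)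
  ultimately show ?thesis by simp
qed

lemma fps_eqI_cong_upto: "(\<And>N. cong_upto N f g) \<Longrightarrow> f = g"
  by (metis cong_upto_def fps_ext lessI)

lemma fps_nth_compose_X_power:
  assumes "0 < j"
  shows "fps_nth (f oo fps_X ^ j) n = (if j dvd n then fps_nth f (n div j) else (0::'a::comm_ring_1))"
proof -
  have "fps_nth (f oo fps_X ^ j) n = (\<Sum>i=0..n. if n = j * i then fps_nth f i else 0)"
    by (simp add: fps_compose_nth power_mult[symmetric] if_distrib cong: if_cong)
  also have "\<dots> = (if j dvd n then fps_nth f (n div j) else 0)"
  proof (cases "j dvd n")
    case True
    then obtain c where c: "n = j * c" ..
    have "(\<Sum>i=0..n. if n = j * i then fps_nth f i else 0) = (\<Sum>i=0..n. if i = c then fps_nth f i else 0)"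
      using assms c by (intro sum.cong) auto
    also have "\<dots> = fps_nth f c" using assms c by (subst sum.delta) auto
    finally show ?thesis using c assms by simp
  next
    case False
    then have "(\<Sum>i=0..n. if n = j * i then fps_nth f i else 0) = (\<Sum>i=0..n. 0)"
      by (intro sum.cong) auto
    then show ?thesis using False by simp
  qed
  finally show ?thesis .
qed

lemma cong_upto_compose:
  assumes "0 < j" "cong_upto N f g"
  shows "cong_upto N (f oo fps_X ^ j) (g oo fps_X ^ j)"
  unfolding cong_upto_def
proof (intro allI impI)
  fix i assume "i < N"
  then have "i div j < N" by (meson div_le_dividend le_less_trans)
  then show "fps_nth (f oo fps_X ^ j) i = fps_nth (g oo fps_X ^ j) i"
    using assms by (simp add: fps_nth_compose_X_power cong_upto_def)
qed

section \<open>Finite truncations of the products \<open>f_k\<close>\<close>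

definition qprod :: "nat \<Rightarrow> nat \<Rightarrow> rat fps" where
  "qprod k n = (\<Prod>m=1..n. (1 - fps_X ^ (k * m)))"

lemma qprod_0 [simp]: "qprod k 0 = 1"
  by (simp add: qprod_def)

lemma qprod_Suc: "qprod k (Suc n) = qprod k n * (1 - fps_X ^ (k * Suc n))"
  by (simp add: qprod_def)

lemma qprod_cong_Suc:
  assumes "1 \<le> k"
  shows "cong_upto (Suc n) (qprod k (Suc n)) (qprod k n)"
proof -
  have "cong_upto (Suc n) (qprod k n + fps_X ^ (k * Suc n) * - qprod k n) (qprod k n + 0)"
    using assms by (intro cong_upto_add cong_upto_X_power_mult_0 cong_upto_refl)
      (use mult_le_mono1[of 1 k "Suc n"] in auto)
  then show ?thesis by (simp add: qprod_Suc algebra_simps)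
qed

text \<open>Once \<open>i\<close> factors are present, each further factor differs from 1 only in
  degrees above \<open>i\<close>, so the coefficient has already settled at its value in
  \<open>fprod\<close>.\<close>

lemma qprod_nth:
  assumes "1 \<le> k" "i \<le> n"
  shows "fps_nth (qprod k n) i = fps_nth (fprod k) i"
  using assms(2)
proof (induction n rule: dec_induct)
  case base
  then show ?case by (simp add: fprod_def qprod_def)
next
  case (step n)
  then show ?case
    using qprod_cong_Suc[OF assms(1), of n] by (simp add: cong_upto_def)
qed

lemma fprod_cong:
  assumes "1 \<le> k" "N \<le> Suc n"
  shows "cong_upto N (fprod k) (qprod k n)"
  using assms by (simp add: cong_upto_def qprod_nth)

lemma qprod_nth_0 [simp]: "1 \<le> k \<Longrightarrow> fps_nth (qprod k n) 0 = 1"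
  by (induction n) (simp_all add: qprod_Suc)

lemma fprod_nth_0 [simp]: "fps_nth (fprod k) 0 = 1"
  by (simp add: fprod_def)

lemma fprod_nonzero [simp]: "fprod k \<noteq> 0"
  using fprod_nth_0 by (metis fps_zero_nth zero_neq_one)

lemma qprod_compose:
  assumes "0 < j"
  shows "qprod k n oo fps_X ^ j = qprod (j * k) n"
proof (induction n)
  case (Suc n)
  have "fps_nth (fps_X ^ j :: rat fps) 0 = 0" using assms by simp
  then show ?case
    by (simp add: Suc qprod_Suc fps_compose_mult_distrib fps_compose_sub_distrib
        fps_X_power_compose algebra_simps del: fps_X_power_nth flip: power_mult)
qed simp

lemma fprod_compose:
  assumes "0 < j" "1 \<le> k"
  shows "fprod k oo fps_X ^ j = fprod (j * k)"
proof (rule fps_eqI_cong_upto)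
  fix N
  have "cong_upto N (fprod k oo fps_X ^ j) (qprod k N oo fps_X ^ j)"
    using assms by (intro cong_upto_compose fprod_cong) auto
  also have "qprod k N oo fps_X ^ j = qprod (j * k) N"
    using assms by (simp add: qprod_compose)
  also have "cong_upto N \<dots> (fprod (j * k))"
    using assms by (intro cong_upto_sym[OF fprod_cong]) auto
  finally show "cong_upto N (fprod k oo fps_X ^ j) (fprod (j * k))" .
qed

section \<open>Jacobi's triple product\<close>

definition qfac :: "rat fps \<Rightarrow> nat \<Rightarrow> rat fps" where
  "qfac Q n = (\<Prod>m=1..n. (1 - Q ^ m))"

text \<open>The Gaussian binomial coefficient with top \<open>i + j\<close>, indexed by its two
  lower parts. The inverses are genuine when \<open>fps_nth Q 0 = 0\<close>, since each
  \<open>qfac Q n\<close> then has constant term 1.\<close>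

definition qbinom :: "rat fps \<Rightarrow> nat \<Rightarrow> nat \<Rightarrow> rat fps" where
  "qbinom Q i j = qfac Q (i + j) * inverse (qfac Q i) * inverse (qfac Q j)"

lemma qfac_0 [simp]: "qfac Q 0 = 1"
  by (simp add: qfac_def)

lemma qfac_Suc: "qfac Q (Suc n) = qfac Q n * (1 - Q ^ Suc n)"
  by (simp add: qfac_def)

lemma qfac_nth_0 [simp]: "fps_nth Q 0 = 0 \<Longrightarrow> fps_nth (qfac Q n) 0 = 1"
  by (induction n) (simp_all add: qfac_Suc)

lemma qbinom_0 [simp]:
  assumes "fps_nth Q 0 = 0"
  shows "qbinom Q 0 j = 1" "qbinom Q i 0 = 1"
  using assms by (simp_all add: qbinom_def inverse_mult_eq_1')

lemma qbinom_mult: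
  assumes "fps_nth Q 0 = 0"
  shows "qbinom Q i j * (qfac Q i * qfac Q j) = qfac Q (i + j)"
proof -
  have "qbinom Q i j * (qfac Q i * qfac Q j) =
      qfac Q (i + j) * (inverse (qfac Q i) * qfac Q i) * (inverse (qfac Q j) * qfac Q j)"
    by (simp add: qbinom_def ac_simps)
  then show ?thesis using assms by (simp add: inverse_mult_eq_1)
qed

text \<open>After clearing denominators, both rules are ways to split
  \<open>1 - Q ^ (i + j + 2)\<close>: as
  \<open>(1 - Q ^ (j + 1)) + Q ^ (j + 1) * (1 - Q ^ (i + 1))\<close>, and the same with
  \<open>i\<close> and \<open>j\<close> exchanged.\<close>

lemma qbinom_pascal:
  assumes "fps_nth Q 0 = 0"
  shows "qbinom Q (Suc i) (Suc j) = qbinom Q (Suc i) j + Q ^ Suc j * qbinom Q i (Suc j)" (is "?l = ?r1")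
    and "qbinom Q (Suc i) (Suc j) = Q ^ Suc i * qbinom Q (Suc i) j + qbinom Q i (Suc j)" (is "_ = ?r2")
proof -
  let ?d = "qfac Q (Suc i) * qfac Q (Suc j)"
  have nz: "?d \<noteq> 0"
    using qfac_nth_0[OF assms, of "Suc i"] qfac_nth_0[OF assms, of "Suc j"] by auto
  have 0: "?l * ?d = qfac Q (Suc (i + j)) * (1 - Q ^ (Suc i + Suc j))"
    using qbinom_mult[OF assms, of "Suc i" "Suc j"] qfac_Suc[of Q "Suc (i + j)"] by simp
  have 1: "qbinom Q (Suc i) j * ?d = qfac Q (Suc (i + j)) * (1 - Q ^ Suc j)"
    using qbinom_mult[OF assms, of "Suc i" j] qfac_Suc[of Q j] by (simp add: ac_simps)
  have 2: "qbinom Q i (Suc j) * ?d = qfac Q (Suc (i + j)) * (1 - Q ^ Suc i)"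
    using qbinom_mult[OF assms, of i "Suc j"] qfac_Suc[of Q i] by (simp add: ac_simps)
  have "?r1 * ?d = qbinom Q (Suc i) j * ?d + Q ^ Suc j * (qbinom Q i (Suc j) * ?d)"
    by (simp only: distrib_right mult.assoc)
  also have "\<dots> = ?l * ?d"
    unfolding 0 1 2 by (simp only: power_add) (simp add: algebra_simps)
  finally show "?l = ?r1" using nz by (metis mult_right_cancel)
  have "?r2 * ?d = Q ^ Suc i * (qbinom Q (Suc i) j * ?d) + (qbinom Q i (Suc j) * ?d)"
    by (simp only: distrib_right mult.assoc)
  also have "\<dots> = ?l * ?d"
    unfolding 0 1 2 by (simp only: power_add) (simp add: algebra_simps)
  finally show "?l = ?r2" using nz by (metis mult_right_cancel)
qed

text \<open>Each Pascal rule, summed against arbitrary weights \<open>u\<close>, turns row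
  \<open>Suc N\<close> into row \<open>N\<close>. In the finite triple product the first form
  absorbs a new factor with \<open>A\<close>, the second one with \<open>B\<close>.\<close>

lemma sum_qbinom_Suc:
  assumes "fps_nth Q 0 = 0"
  shows "(\<Sum>i\<le>Suc N. u i * qbinom Q i (Suc N - i)) =
      (\<Sum>i\<le>N. (u i + Q ^ (N - i) * u (Suc i)) * qbinom Q i (N - i))" (is "?l = ?r1")
    and "(\<Sum>i\<le>Suc N. u i * qbinom Q i (Suc N - i)) =
      (\<Sum>i\<le>N. (Q ^ i * u i + u (Suc i)) * qbinom Q i (N - i))" (is "_ = ?r2")
proof -
  have l: "?l = u 0 * qbinom Q 0 (Suc N) + (\<Sum>i<N. u (Suc i) * qbinom Q (Suc i) (N - i))
      + u (Suc N) * qbinom Q (Suc N) 0"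
    unfolding sum.atMost_Suc_shift by (simp flip: lessThan_Suc_atMost)
  have s: "(\<Sum>i\<le>N. f i) = f 0 + (\<Sum>i<N. f (Suc i))" for f :: "nat \<Rightarrow> rat fps"
    by (metis sum.atMost_shift)
  have s': "(\<Sum>i\<le>N. f i) = (\<Sum>i<N. f i) + f N" for f :: "nat \<Rightarrow> rat fps"
    by (simp flip: lessThan_Suc_atMost)
  have p1: "qbinom Q (Suc i) (N - i) = qbinom Q (Suc i) (N - Suc i) + Q ^ (N - i) * qbinom Q i (N - i)"
    and p2: "qbinom Q (Suc i) (N - i) = Q ^ Suc i * qbinom Q (Suc i) (N - Suc i) + qbinom Q i (N - i)"
    if "i < N" for i
    using qbinom_pascal[OF assms, of i "N - Suc i"] that by (simp_all add: Suc_diff_Suc)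
  have "?r1 = (\<Sum>i\<le>N. u i * qbinom Q i (N - i)) + (\<Sum>i\<le>N. u (Suc i) * (Q ^ (N - i) * qbinom Q i (N - i)))"
    by (simp add: algebra_simps sum.distrib)
  also have "\<dots> = u 0 * qbinom Q 0 N + (\<Sum>i<N. u (Suc i) * qbinom Q (Suc i) (N - i)) + u (Suc N) * qbinom Q N 0"
    by (subst s, subst s') (simp add: p1 algebra_simps sum.distrib)
  finally show "?l = ?r1" unfolding l using assms by simp
  have "?r2 = (\<Sum>i\<le>N. u i * (Q ^ i * qbinom Q i (N - i))) + (\<Sum>i\<le>N. u (Suc i) * qbinom Q i (N - i))"
    by (simp add: algebra_simps sum.distrib)
  also have "\<dots> = u 0 * qbinom Q 0 N + (\<Sum>i<N. u (Suc i) * qbinom Q (Suc i) (N - i)) + u (Suc N) * qbinom Q N 0"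
    by (subst s, subst s') (simp add: p2 algebra_simps sum.distrib)
  finally show "?l = ?r2" unfolding l using assms by simp
qed

section \<open>Triangular exponents and the terms of a theta series\<close>

definition tri_num :: "int \<Rightarrow> nat" where
  "tri_num k = nat (k * (k + 1) div 2)"

definition theta_term :: "'a::comm_ring_1 \<Rightarrow> 'a \<Rightarrow> int \<Rightarrow> 'a" where
  "theta_term A B k = A ^ tri_num k * B ^ tri_num (k - 1)"

text \<open>The product \<open>k * (k + 1)\<close> is even and never negative, so neither
  \<open>div\<close> nor \<open>nat\<close> loses anything, also for negative
  \<open>k\<close>.\<close>

lemma tri_num_eq: "2 * int (tri_num k) = k * (k + 1)"
proof -
  have "k * (k + 1) \<ge> 0"
    by (cases "k \<ge> 0") (auto simp: zero_le_mult_iff)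
  then show ?thesis by (simp add: tri_num_def)
qed

lemma tri_num_minus: "tri_num (- k) = tri_num (k - 1)"
  by (simp add: tri_num_def algebra_simps)

lemma tri_num_eqI: "2 * int n = k * (k + 1) \<Longrightarrow> n = tri_num k"
  using tri_num_eq[of k] by linarith

lemma tri_num_0 [simp]: "tri_num 0 = 0" "tri_num (-1) = 0"
  by (simp_all add: tri_num_def)

lemma tri_num_step: "int (tri_num (k + 1)) = int (tri_num k) + k + 1"
  using tri_num_eq[of k] tri_num_eq[of "k + 1"] by (simp add: algebra_simps)

lemma tri_num_step': "int (tri_num k) = int (tri_num (k - 1)) + k"
  using tri_num_step[of "k - 1"] by simp

lemma theta_term_0 [simp]: "theta_term A B 0 = 1"
  by (simp add: theta_term_def)

lemma theta_term_minus: "theta_term A B (- k) = theta_term B A k"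
proof -
  have "tri_num (- k - 1) = tri_num k"
    by (simp add: tri_num_def algebra_simps)
  then show ?thesis by (simp add: theta_term_def tri_num_minus mult.commute)
qed

text \<open>Formally the quotient of consecutive terms is \<open>A * (A * B) ^ k\<close>.
  Multiplying through by \<open>(A * B) ^ (m - k)\<close> avoids negative exponents.\<close>

lemma theta_term_shift_up:
  assumes "k \<le> int m"
  shows "(A * B) ^ nat (int m - k) * theta_term A B (k + 1) = A * (A * B) ^ m * theta_term A B k"
proof -
  have "nat (int m - k) + tri_num (k + 1) = Suc m + tri_num k"
    and "nat (int m - k) + tri_num k = m + tri_num (k - 1)"
    using assms tri_num_step[of k] tri_num_step'[of k] by linarith+
  then have "A ^ (nat (int m - k) + tri_num (k + 1)) * B ^ (nat (int m - k) + tri_num k) =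
      A ^ (Suc m + tri_num k) * B ^ (m + tri_num (k - 1))"
    by simp
  then show ?thesis
    by (simp add: theta_term_def power_add power_mult_distrib ac_simps)
qed

lemma theta_term_shift_down:
  assumes "- k \<le> int n"
  shows "(A * B) ^ nat (int n + k) * theta_term A B (k - 1) = B * (A * B) ^ n * theta_term A B k"
  using theta_term_shift_up[of "- k" n B A] theta_term_minus[of A B "- (k - 1)"] assms
  by (simp add: theta_term_minus ac_simps)

text \<open>The finite form of the triple product, by induction on the number of factors: first
  those with \<open>B\<close> while \<open>m = 0\<close>, then those with \<open>A\<close>. Each new
  factor is absorbed by a Pascal rule and a shift of the theta index.\<close>

lemma jacobi_finite:
  fixes A B :: "rat fps"
  assumes "fps_nth (A * B) 0 = 0"
  shows "(\<Prod>j<m. (1 + A * (A * B) ^ j)) * (\<Prod>j<n. (1 + B * (A * B) ^ j)) =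
    (\<Sum>i\<le>m + n. theta_term A B (int i - int n) * qbinom (A * B) i (m + n - i))"
proof (induction m)
  case 0
  show ?case
  proof (induction n)
    case 0
    show ?case using assms by simp
  next
    case (Suc n)
    \<comment> \<open>The offset in the theta index grows with \<open>n\<close>, so the old terms
      reappear as \<open>u (Suc i)\<close> in the second summed Pascal rule, while
      \<open>u i\<close> supplies the multiple by \<open>B * (A * B) ^ n\<close>.\<close>
    have eq: "(A * B) ^ i * theta_term A B (int i - int (Suc n)) = B * (A * B) ^ n * theta_term A B (int i - int n)" for i
      using theta_term_shift_down[of "int i - int n" n A B] by (simp add: algebra_simps)
    have "(\<Sum>i\<le>0 + Suc n. theta_term A B (int i - int (Suc n)) * qbinom (A * B) i (0 + Suc n - i)) =
       (\<Sum>i\<le>n. (B * (A * B) ^ n * theta_term A B (int i - int n) + theta_term A B (int i - int n)) * qbinom (A * B) i (n - i))"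
      unfolding add_0 by (subst sum_qbinom_Suc(2)[OF assms], subst eq) simp
    also have "\<dots> = (1 + B * (A * B) ^ n) * (\<Sum>i\<le>0 + n. theta_term A B (int i - int n) * qbinom (A * B) i (0 + n - i))"
      by (simp add: sum_distrib_left sum.distrib algebra_simps)
    also have "\<dots> = (\<Prod>j<0. (1 + A * (A * B) ^ j)) * (\<Prod>j<Suc n. (1 + B * (A * B) ^ j))"
      by (subst Suc[symmetric]) (simp add: ac_simps)
    finally show ?case by (rule sym)
  qed
next
  case (Suc m)
  have eq: "(A * B) ^ (m + n - i) * theta_term A B (int (Suc i) - int n) = A * (A * B) ^ m * theta_term A B (int i - int n)"
    if "i \<le> m + n" for i
  proof -
    have "nat (int m - (int i - int n)) = m + n - i" using that by linarith
    then show ?thesis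
      using theta_term_shift_up[of "int i - int n" m A B] that by (simp add: algebra_simps)
  qed
  have "(\<Sum>i\<le>Suc m + n. theta_term A B (int i - int n) * qbinom (A * B) i (Suc m + n - i)) =
      (\<Sum>i\<le>m + n. (theta_term A B (int i - int n) + (A * B) ^ (m + n - i) * theta_term A B (int (Suc i) - int n)) *
         qbinom (A * B) i (m + n - i))"
    unfolding add_Suc by (rule sum_qbinom_Suc(1)[OF assms])
  also have "\<dots> = (\<Sum>i\<le>m + n. (theta_term A B (int i - int n) + A * (A * B) ^ m * theta_term A B (int i - int n)) *
         qbinom (A * B) i (m + n - i))"
    by (intro sum.cong refl) (simp only: eq atMost_iff)
  also have "\<dots> = (1 + A * (A * B) ^ m) * (\<Sum>i\<le>m + n. theta_term A B (int i - int n) * qbinom (A * B) i (m + n - i))"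
    by (simp add: sum_distrib_left sum.distrib algebra_simps)
  also have "\<dots> = (\<Prod>j<Suc m. (1 + A * (A * B) ^ j)) * (\<Prod>j<n. (1 + B * (A * B) ^ j))"
    by (subst Suc[symmetric]) (simp add: ac_simps)
  finally show ?case by (rule sym)
qed

section \<open>Theta series as limits of finite products\<close>

definition theta_partial :: "nat \<Rightarrow> 'a::comm_ring_1 \<Rightarrow> 'a \<Rightarrow> 'a" where
  "theta_partial M A B = (\<Sum>k=-int M..int M. theta_term A B k)"

text \<open>Says that \<open>F\<close> is Ramanujan's theta series \<open>f(A,B)\<close>, the sum of
  \<open>A^(k(k+1)/2) B^(k(k-1)/2)\<close> over all integers \<open>k\<close>.\<close>
definition is_theta :: "rat fps \<Rightarrow> rat fps \<Rightarrow> rat fps \<Rightarrow> bool" where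
  "is_theta F A B \<longleftrightarrow> (\<forall>N. \<exists>M0. \<forall>M\<ge>M0. cong_upto N F (theta_partial M A B))"

lemma qfac_X_power: "qfac (fps_X ^ d) n = qprod d n"
  by (simp add: qfac_def qprod_def power_mult)

text \<open>All three \<open>q\<close>-factorials have at least \<open>N\<close> factors and so
  agree with \<open>f_d\<close> modulo \<open>fps_X ^ N\<close>; the binomial thus tends to
  \<open>1 / f_d\<close>.\<close>

lemma qbinom_cong:
  assumes "1 \<le> d" "N \<le> i" "N \<le> j"
  shows "cong_upto N (qbinom (fps_X ^ d) i j * fprod d) 1"
proof -
  have F: "cong_upto N (qprod d n) (fprod d)" if "N \<le> n" for n
    using assms that by (intro cong_upto_sym[OF fprod_cong]) auto
  have "cong_upto N (qbinom (fps_X ^ d) i j * fprod d)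
      (fprod d * inverse (fprod d) * inverse (fprod d) * fprod d)"
    unfolding qbinom_def qfac_X_power using assms
    by (intro cong_upto_mult cong_upto_inverse F cong_upto_refl) auto
  also have "fprod d * inverse (fprod d) * inverse (fprod d) * fprod d = 1"
    by (simp add: inverse_mult_eq_1 inverse_mult_eq_1' mult.assoc)
  finally show ?thesis .
qed

lemma theta_term_cong_0:
  fixes s :: rat
  assumes "1 \<le> a + b" "int N < \<bar>k\<bar>"
  shows "cong_upto N (theta_term (fps_const s * fps_X ^ a) (fps_const s * fps_X ^ b) k * f) 0"
proof -
  let ?e = "a * tri_num k + b * tri_num (k - 1)"
  have "N \<le> tri_num k" "N \<le> tri_num (k - 1)"
  proof -
    have "2 * int N \<le> k * (k + 1)" "2 * int N \<le> k * (k - 1)"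
    proof -
      \<comment> \<open>Both \<open>k * (k + 1)\<close> and \<open>k * (k - 1)\<close> are at least
        \<open>\<bar>k\<bar> * (\<bar>k\<bar> - 1)\<close>, which is smallest at
        \<open>\<bar>k\<bar> = N + 1\<close>.\<close>
      have "(int N + 1) * int N \<le> \<bar>k\<bar> * (\<bar>k\<bar> - 1)"
        using assms(2) by (intro mult_mono) auto
      moreover have "2 * int N \<le> (int N + 1) * int N"
        by (cases N) (auto simp: algebra_simps)
      moreover have "\<bar>k\<bar> * (\<bar>k\<bar> - 1) \<le> k * (k + 1)" "\<bar>k\<bar> * (\<bar>k\<bar> - 1) \<le> k * (k - 1)"
        by (auto simp: abs_if algebra_simps)
      ultimately show "2 * int N \<le> k * (k + 1)" "2 * int N \<le> k * (k - 1)" by linarith+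
    qed
    then show "N \<le> tri_num k" "N \<le> tri_num (k - 1)"
      using tri_num_eq[of k] tri_num_eq[of "k - 1"] by (auto simp: algebra_simps)
  qed
  then have "a * N + b * N \<le> ?e" by (intro add_mono mult_le_mono2)
  moreover have "1 * N \<le> (a + b) * N" using assms(1) by (rule mult_le_mono1)
  ultimately have "N \<le> ?e" by (simp add: algebra_simps)
  then have "cong_upto N (fps_X ^ ?e * (fps_const s ^ (tri_num k + tri_num (k - 1)) * f)) 0"
    by (rule cong_upto_X_power_mult_0)
  then show ?thesis
    by (simp add: theta_term_def power_add power_mult power_mult_distrib ac_simps
        del: fps_const_power fps_const_mult)
qed

text \<open>Take \<open>m = n = M\<close> in the finite form. For
  \<open>\<bar>k\<bar> \<le> N\<close> the binomial times \<open>f_d\<close> is 1 modulo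
  \<open>fps_X ^ N\<close>, and all other terms vanish there. The sign \<open>s\<close> disappears
  from \<open>A * B\<close>, which is \<open>fps_X ^ d\<close>.\<close>

lemma jacobi_triple_product:
  fixes s :: rat and a b d N M :: nat
  defines "A \<equiv> fps_const s * fps_X ^ a" and "B \<equiv> fps_const s * fps_X ^ b"
  assumes s: "s * s = 1" and d: "a + b = d" "1 \<le> d" and M: "2 * N \<le> M"
  shows "cong_upto N (fprod d * (\<Prod>j<M. (1 + A * fps_X ^ (d * j)) * (1 + B * fps_X ^ (d * j))))
     (theta_partial M A B)"
proof -
  have AB: "A * B = fps_X ^ d"
  proof -
    have "A * B = fps_const (s * s) * fps_X ^ (a + b)"
      unfolding A_def B_def fps_const_mult[symmetric] power_add by (simp only: ac_simps)
    then show ?thesis using s d by simp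
  qed
  have AB0: "fps_nth (A * B) 0 = 0" using AB d by simp
  let ?g = "\<lambda>i. theta_term A B (int i - int M) * qbinom (A * B) i (M + M - i)"
  let ?h = "\<lambda>k. theta_term A B k * qbinom (fps_X ^ d) (nat (int M + k)) (nat (int M - k))"
  have "(\<Prod>j<M. (1 + A * fps_X ^ (d * j)) * (1 + B * fps_X ^ (d * j))) = (\<Sum>i\<le>M + M. ?g i)"
    using jacobi_finite[OF AB0, of M M] by (simp add: AB prod.distrib power_mult)
  also have "\<dots> = (\<Sum>k=-int M..int M. ?h k)"
    by (rule sum.reindex_bij_witness[of _ "\<lambda>k. nat (int M + k)" "\<lambda>i. int i - int M"])
      (auto simp: AB nat_diff_distrib' nat_add_distrib intro!: arg_cong2[where f = "qbinom _"])
  finally have eq: "fprod d * (\<Prod>j<M. (1 + A * fps_X ^ (d * j)) * (1 + B * fps_X ^ (d * j))) =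
      (\<Sum>k=-int M..int M. fprod d * ?h k)"
    by (simp add: sum_distrib_left)
  show ?thesis
    unfolding eq theta_partial_def
  proof (rule cong_upto_sum)
    fix k assume k: "k \<in> {-int M..int M}"
    show "cong_upto N (fprod d * ?h k) (theta_term A B k)"
    proof (cases "\<bar>k\<bar> \<le> int N")
      case True
      \<comment> \<open>Since \<open>2 * N \<le> M\<close>, both lower parts \<open>M + k\<close>
        and \<open>M - k\<close> are at least \<open>N\<close>.\<close>
      have "cong_upto N (theta_term A B k * (qbinom (fps_X ^ d) (nat (int M + k)) (nat (int M - k)) * fprod d))
          (theta_term A B k * 1)"
        using True M d by (intro cong_upto_mult cong_upto_refl qbinom_cong) auto
      then show ?thesis by (simp add: ac_simps)
    next
      case False
      then have "cong_upto N (theta_term A B k * f) 0" for f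
        unfolding A_def B_def using d by (intro theta_term_cong_0) auto
      from cong_upto_trans[OF this cong_upto_sym[OF this]]
      have "cong_upto N (theta_term A B k * (qbinom (fps_X ^ d) (nat (int M + k)) (nat (int M - k)) * fprod d))
          (theta_term A B k * 1)" .
      then show ?thesis by (simp add: ac_simps)
    qed
  qed
qed

text \<open>A criterion for recognising an eta-type quotient \<open>U / V\<close> as a theta series:
  the denominator is cleared, so that only identities between finite products remain to be
  checked.\<close>

lemma is_theta_quotientI:
  fixes s :: rat and a b d :: nat
  defines "A \<equiv> fps_const s * fps_X ^ a" and "B \<equiv> fps_const s * fps_X ^ b"
  assumes s: "s * s = 1" and d: "a + b = d" "1 \<le> d"
    and V: "fps_nth V 0 = 1"
    and UV: "\<And>N M. N \<le> M \<Longrightarrow> cong_upto N U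
      (V * (fprod d * (\<Prod>j<M. (1 + A * fps_X ^ (d * j)) * (1 + B * fps_X ^ (d * j)))))"
  shows "is_theta (U * inverse V) A B"
  unfolding is_theta_def
proof (intro allI exI impI)
  fix N M :: nat assume M: "2 * N \<le> M"
  have "cong_upto N (inverse V * U) (inverse V * 
      (V * (fprod d * (\<Prod>j<M. (1 + A * fps_X ^ (d * j)) * (1 + B * fps_X ^ (d * j))))))"
    using M by (intro cong_upto_mult cong_upto_refl UV) auto
  also have "\<dots> = fprod d * (\<Prod>j<M. (1 + A * fps_X ^ (d * j)) * (1 + B * fps_X ^ (d * j)))"
    using V by (simp add: inverse_mult_eq_1 flip: mult.assoc)
  also have "cong_upto N \<dots> (theta_partial M A B)"
    unfolding A_def B_def using s d M by (rule jacobi_triple_product)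
  finally show "cong_upto N (U * inverse V) (theta_partial M A B)"
    by (simp add: mult.commute)
qed

section \<open>Symmetry, substitution and trisection of theta series\<close>

lemma theta_partial_commute: "theta_partial M A B = theta_partial M B A"
  unfolding theta_partial_def
  by (rule sum.reindex_bij_witness[of _ uminus uminus]) (auto simp: theta_term_minus)

lemma is_theta_commute: "is_theta F A B \<longleftrightarrow> is_theta F B A"
  by (simp add: is_theta_def theta_partial_commute)

lemma is_theta_compose:
  assumes "is_theta F A B" "0 < j"
  shows "is_theta (F oo fps_X ^ j) (A oo fps_X ^ j) (B oo fps_X ^ j)"
proof -
  have X: "fps_nth (fps_X ^ j :: rat fps) 0 = 0" using assms(2) by simp
  have "theta_partial M A B oo fps_X ^ j = theta_partial M (A oo fps_X ^ j) (B oo fps_X ^ j)" for M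
    by (simp add: theta_partial_def theta_term_def fps_compose_sum_distrib fps_compose_mult_distrib[OF X]
        fps_compose_power[OF X])
  moreover have "\<forall>N. \<exists>M0. \<forall>M\<ge>M0. cong_upto N (F oo fps_X ^ j) (theta_partial M A B oo fps_X ^ j)"
    using assms(1) cong_upto_compose[OF assms(2)] unfolding is_theta_def by blast
  ultimately show ?thesis by (simp add: is_theta_def)
qed

text \<open>In each residue class of the index modulo 3, the exponents are again combinations of
  \<open>tri_num l\<close> and \<open>tri_num (l - 1)\<close>, so each class is a theta series with
  new arguments.\<close>

lemma theta_term_3:
  shows "theta_term A B (3 * l) = theta_term (A ^ 6 * B ^ 3) (A ^ 3 * B ^ 6) l"
    and "theta_term A B (3 * l + 1) = A * theta_term (A ^ 9 * B ^ 6) (B ^ 3) l"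
    and "theta_term A B (3 * l - 1) = B * theta_term (A ^ 3) (A ^ 6 * B ^ 9) l"
proof -
  have l: "2 * int (tri_num l) = l * (l + 1)" "2 * int (tri_num (l - 1)) = l * (l - 1)"
    using tri_num_eq[of l] tri_num_eq[of "l - 1"] by (simp_all add: algebra_simps)
  have t: "tri_num (3 * l) = 6 * tri_num l + 3 * tri_num (l - 1)"
    "tri_num (3 * l - 1) = 3 * tri_num l + 6 * tri_num (l - 1)"
    "tri_num (3 * l + 1) = 1 + 9 * tri_num l"
    "tri_num (3 * l + 1 - 1) = 6 * tri_num l + 3 * tri_num (l - 1)"
    "tri_num (3 * l - 1 - 1) = 1 + 9 * tri_num (l - 1)"
    by (rule sym, rule tri_num_eqI, use l in \<open>simp add: algebra_simps\<close>)+
  show "theta_term A B (3 * l) = theta_term (A ^ 6 * B ^ 3) (A ^ 3 * B ^ 6) l"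
    "theta_term A B (3 * l + 1) = A * theta_term (A ^ 9 * B ^ 6) (B ^ 3) l"
    "theta_term A B (3 * l - 1) = B * theta_term (A ^ 3) (A ^ 6 * B ^ 9) l"
    unfolding theta_term_def t
    by (simp_all add: power_add power_mult_distrib ac_simps flip: power_mult)
qed

text \<open>The bound \<open>3 * M + 1\<close> is chosen so that the interval is exactly the union
  of the triples around \<open>3 * l\<close> for \<open>\<bar>l\<bar> \<le> M\<close>.\<close>

lemma sum_int_interval_mod_3:
  fixes f :: "int \<Rightarrow> 'a::comm_monoid_add"
  shows "(\<Sum>k=-int (3 * M + 1)..int (3 * M + 1). f k) =
    (\<Sum>l=-int M..int M. f (3 * l) + f (3 * l + 1) + f (3 * l - 1))"
proof (induction M)
  case 0
  have "{-1..1::int} = {-1, 0, 1}" by auto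
  then show ?case by (simp add: ac_simps)
next
  case (Suc M)
  have 1: "{-int (3 * Suc M + 1)..int (3 * Suc M + 1)} = {-int (3 * M + 1)..int (3 * M + 1)} \<union>
      {3 * int (Suc M), 3 * int (Suc M) + 1, 3 * int (Suc M) - 1,
       3 * - int (Suc M), 3 * - int (Suc M) + 1, 3 * - int (Suc M) - 1}"
    by auto
  have 2: "{-int (Suc M)..int (Suc M)} = {-int M..int M} \<union> {int (Suc M), - int (Suc M)}"
    by auto
  have "(\<Sum>k=-int (3 * Suc M + 1)..int (3 * Suc M + 1). f k) =
      (\<Sum>k=-int (3 * M + 1)..int (3 * M + 1). f k) +
      (\<Sum>k\<in>{3 * int (Suc M), 3 * int (Suc M) + 1, 3 * int (Suc M) - 1,
       3 * - int (Suc M), 3 * - int (Suc M) + 1, 3 * - int (Suc M) - 1}. f k)"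
    unfolding 1 by (rule sum.union_disjoint) auto
  also have "\<dots> = (\<Sum>l=-int M..int M. f (3 * l) + f (3 * l + 1) + f (3 * l - 1)) +
      (\<Sum>l\<in>{int (Suc M), - int (Suc M)}. f (3 * l) + f (3 * l + 1) + f (3 * l - 1))"
    unfolding Suc by (rule arg_cong2[where f = "(+)"]) (simp_all add: add_ac)
  also have "\<dots> = (\<Sum>l=-int (Suc M)..int (Suc M). f (3 * l) + f (3 * l + 1) + f (3 * l - 1))"
    unfolding 2 by (rule sum.union_disjoint[symmetric]) auto
  finally show ?case .
qed

lemma theta_partial_3:
  "theta_partial (3 * M + 1) A B = theta_partial M (A ^ 6 * B ^ 3) (A ^ 3 * B ^ 6) +
     A * theta_partial M (A ^ 9 * B ^ 6) (B ^ 3) + B * theta_partial M (A ^ 3) (A ^ 6 * B ^ 9)"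
  unfolding theta_partial_def sum_int_interval_mod_3 theta_term_3
  by (simp add: sum.distrib sum_distrib_left)

lemma theta_dissection_3:
  assumes "is_theta F A B" "is_theta F0 (A ^ 6 * B ^ 3) (A ^ 3 * B ^ 6)"
    "is_theta F1 (A ^ 9 * B ^ 6) (B ^ 3)" "is_theta F2 (A ^ 3) (A ^ 6 * B ^ 9)"
  shows "F = F0 + A * F1 + B * F2"
proof (rule fps_eqI_cong_upto)
  fix N
  obtain M M0 M1 M2 where
    M: "\<And>m. M \<le> m \<Longrightarrow> cong_upto N F (theta_partial m A B)"
    "\<And>m. M0 \<le> m \<Longrightarrow> cong_upto N F0 (theta_partial m (A ^ 6 * B ^ 3) (A ^ 3 * B ^ 6))"
    "\<And>m. M1 \<le> m \<Longrightarrow> cong_upto N F1 (theta_partial m (A ^ 9 * B ^ 6) (B ^ 3))"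
    "\<And>m. M2 \<le> m \<Longrightarrow> cong_upto N F2 (theta_partial m (A ^ 3) (A ^ 6 * B ^ 9))"
    using assms unfolding is_theta_def by metis
  \<comment> \<open>One index beyond all four thresholds: the series on the left is cut at
    \<open>3 * m + 1\<close>, the three on the right at \<open>m\<close>.\<close>
  define m where "m = M + M0 + M1 + M2"
  have "cong_upto N F (theta_partial (3 * m + 1) A B)"
    by (rule M) (simp add: m_def)
  also have "cong_upto N \<dots> (F0 + A * F1 + B * F2)"
    unfolding theta_partial_3
    by (rule cong_upto_sym, intro cong_upto_add cong_upto_mult cong_upto_refl M) (simp_all add: m_def)
  finally show "cong_upto N F (F0 + A * F1 + B * F2)" .
qed

section \<open>The 3-dissection of $f_1 f_2$\<close>

text \<open>Ramanujan's \<open>phi(-q) = f_1^2 / f_2\<close>. The finite identity \<open>fin\<close>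
  separates the even from the odd factors of \<open>f_1\<close>.\<close>

lemma is_theta_phi:
  "is_theta (fprod 1 ^ 2 * inverse (fprod 2)) (- fps_X) (- fps_X)"
proof -
  have fin: "qprod 1 (2 * M) ^ 2 = qprod 2 M * (qprod 2 M * (\<Prod>j<M. (1 - fps_X * fps_X ^ (2 * j)) ^ 2))" for M
  proof (induction M)
    case (Suc M)
    define y :: "rat fps" where "y = fps_X ^ (2 * M)"
    define P where "P = (\<Prod>j<M. (1 - fps_X * fps_X ^ (2 * j)) ^ 2 :: rat fps)"
    have "qprod 1 (2 * Suc M) = qprod 1 (2 * M) * (1 - fps_X * y) * (1 - fps_X ^ 2 * y)"
      and 2: "qprod 2 (Suc M) = qprod 2 M * (1 - fps_X ^ 2 * y)"
      by (simp_all add: qprod_Suc y_def power2_eq_square mult.assoc)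
    then have "qprod 1 (2 * Suc M) ^ 2 = qprod 1 (2 * M) ^ 2 * ((1 - fps_X * y) * (1 - fps_X ^ 2 * y)) ^ 2"
      by (simp only: power_mult_distrib mult.assoc)
    also have "\<dots> = qprod 2 (Suc M) * (qprod 2 (Suc M) * (P * (1 - fps_X * y) ^ 2))"
      unfolding Suc 2 P_def[symmetric] by (simp only: power2_eq_square ac_simps)
    finally show ?case by (simp add: P_def y_def)
  qed simp
  have "is_theta (fprod 1 ^ 2 * inverse (fprod 2)) (fps_const (-1) * fps_X ^ 1) (fps_const (-1) * fps_X ^ 1)"
  proof (rule is_theta_quotientI[where d = 2])
    fix N M :: nat assume "N \<le> M"
    then have c: "cong_upto N (qprod 2 M) (fprod 2)" "cong_upto N (fprod 1) (qprod 1 (2 * M))"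
      by (intro cong_upto_sym[OF fprod_cong] fprod_cong; simp)+
    have "cong_upto N (fprod 1 ^ 2) (qprod 1 (2 * M) ^ 2)"
      by (intro cong_upto_power c)
    also have "cong_upto N \<dots> (fprod 2 * (fprod 2 * (\<Prod>j<M. (1 - fps_X * fps_X ^ (2 * j)) ^ 2)))"
      unfolding fin by (intro cong_upto_mult c cong_upto_refl)
    finally show "cong_upto N (fprod 1 ^ 2) (fprod 2 * (fprod 2 * (\<Prod>j<M.
        (1 + fps_const (-1) * fps_X ^ 1 * fps_X ^ (2 * j)) * (1 + fps_const (-1) * fps_X ^ 1 * fps_X ^ (2 * j)))))"
      by (simp add: power2_eq_square flip: fps_const_neg)
  qed simp_all
  then show ?thesis by (simp flip: fps_const_neg)
qed

text \<open>The series \<open>f(1,q)\<close> is twice Ramanujan's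
  \<open>psi(q) = f_2^2 / f_1\<close>. In \<open>fin\<close> the product of the
  \<open>1 + fps_X ^ j\<close> starts at \<open>j = 0\<close>, whence the 2, and lacks a second
  factor \<open>1 + fps_X ^ M\<close>, which is 1 modulo \<open>fps_X ^ N\<close>.\<close>

lemma is_theta_psi:
  "is_theta (2 * fprod 2 ^ 2 * inverse (fprod 1)) 1 fps_X"
proof -
  have fin: "qprod 1 M * (qprod 1 M * (\<Prod>j<M. (1 + fps_X ^ j) * (1 + fps_X * fps_X ^ j))) * (1 + fps_X ^ M) =
    2 * qprod 2 M ^ 2" for M
  proof (induction M)
    case (Suc M)
    define y :: "rat fps" where "y = fps_X ^ M"
    define P where "P = (\<Prod>j<M. (1 + fps_X ^ j) * (1 + fps_X * fps_X ^ j) :: rat fps)"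
    have X: "fps_X ^ (2 * Suc M) = fps_X * y * (fps_X * y)"
      by (simp only: y_def mult_2 power_add power_Suc)
    have 1: "qprod 1 (Suc M) = qprod 1 M * (1 - fps_X * y)"
      "qprod 2 (Suc M) = qprod 2 M * ((1 - fps_X * y) * (1 + fps_X * y))"
      unfolding qprod_Suc X by (simp_all add: y_def algebra_simps)
    have "2 * qprod 2 (Suc M) ^ 2 = (2 * qprod 2 M ^ 2) * ((1 - fps_X * y) * (1 + fps_X * y)) ^ 2"
      unfolding 1 by (simp add: power_mult_distrib)
    also have "\<dots> = qprod 1 M * (qprod 1 M * P) * (1 + y) * ((1 - fps_X * y) * (1 + fps_X * y)) ^ 2"
      using Suc by (simp add: P_def y_def)
    also have "\<dots> = qprod 1 (Suc M) * (qprod 1 (Suc M) * (P * ((1 + y) * (1 + fps_X * y)))) * (1 + fps_X * y)"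
      unfolding 1 by algebra
    finally show ?case by (simp add: P_def y_def)
  qed simp
  have "is_theta (2 * fprod 2 ^ 2 * inverse (fprod 1)) (fps_const 1 * fps_X ^ 0) (fps_const 1 * fps_X ^ 1)"
  proof (rule is_theta_quotientI[where d = 1])
    fix N M :: nat assume "N \<le> M"
    then have c: "cong_upto N (qprod 1 M) (fprod 1)" "cong_upto N (fprod 2) (qprod 2 M)"
      by (intro cong_upto_sym[OF fprod_cong] fprod_cong; simp)+
    have c': "cong_upto N (1 + fps_X ^ M * 1) (1 + 0 :: rat fps)"
      by (intro cong_upto_add cong_upto_refl cong_upto_X_power_mult_0 \<open>N \<le> M\<close>)
    have "cong_upto N (2 * fprod 2 ^ 2) (2 * qprod 2 M ^ 2)"
      by (intro cong_upto_mult cong_upto_power c cong_upto_refl)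
    also have "\<dots> = qprod 1 M * (qprod 1 M * (\<Prod>j<M. (1 + fps_X ^ j) * (1 + fps_X * fps_X ^ j))) * (1 + fps_X ^ M * 1)"
      by (simp only: fin mult_1_right)
    also have "cong_upto N \<dots> (fprod 1 * (fprod 1 * (\<Prod>j<M. (1 + fps_X ^ j) * (1 + fps_X * fps_X ^ j))) * (1 + 0))"
      by (intro cong_upto_mult c c' cong_upto_refl)
    finally show "cong_upto N (2 * fprod 2 ^ 2) (fprod 1 * (fprod 1 * (\<Prod>j<M.
        (1 + fps_const 1 * fps_X ^ 0 * fps_X ^ (1 * j)) * (1 + fps_const 1 * fps_X ^ 1 * fps_X ^ (1 * j)))))"
      by simp
  qed simp_all
  then show ?thesis by simp
qed

text \<open>Writing \<open>1 + x\<close> as \<open>(1 - x^2) / (1 - x)\<close>, the product of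
  \<open>1 + q^m\<close> over \<open>m\<close> prime to 3 is \<open>f_2 / f_1\<close> with the
  multiples of 3, \<open>f_6 / f_3\<close>, divided out.\<close>

lemma is_theta_A:
  "is_theta (fprod 2 * fprod 3 ^ 2 * inverse (fprod 1 * fprod 6)) fps_X (fps_X ^ 2)"
proof -
  have fin: "qprod 1 (3 * M) * qprod 6 M * (\<Prod>j<M. (1 + fps_X * fps_X ^ (3 * j)) * (1 + fps_X ^ 2 * fps_X ^ (3 * j))) =
    qprod 2 (3 * M) * qprod 3 M" for M
  proof (induction M)
    case (Suc M)
    define y :: "rat fps" where "y = fps_X ^ (3 * M)"
    define P where "P = (\<Prod>j<M. (1 + fps_X * fps_X ^ (3 * j)) * (1 + fps_X ^ 2 * fps_X ^ (3 * j)) :: rat fps)"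
    have 1: "3 * Suc M = Suc (Suc (Suc (3 * M)))" by simp
    have e: "fps_X ^ n = fps_X * y" if "n = 1 + 3 * M" for n
      unfolding that power_add y_def by simp
    have e': "fps_X ^ n = fps_X ^ a * y" if "n = a + 3 * M" for n a
      unfolding that power_add y_def ..
    have e'': "fps_X ^ n = fps_X ^ a * y ^ 2" if "n = a + 6 * M" for n a
      unfolding that power_add y_def by (simp flip: power_mult)
    have 2: "qprod 1 (3 * Suc M) = qprod 1 (3 * M) * (1 - fps_X * y) * (1 - fps_X ^ 2 * y) * (1 - fps_X ^ 3 * y)"
      "qprod 2 (3 * Suc M) = qprod 2 (3 * M) * (1 - fps_X ^ 2 * y ^ 2) * (1 - fps_X ^ 4 * y ^ 2) * (1 - fps_X ^ 6 * y ^ 2)"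
      "qprod 3 (Suc M) = qprod 3 M * (1 - fps_X ^ 3 * y)"
      "qprod 6 (Suc M) = qprod 6 M * (1 - fps_X ^ 6 * y ^ 2)"
      unfolding 1 qprod_Suc
      by (intro arg_cong2[where f = "(*)"] arg_cong2[where f = "(-)"] refl e e' e''; simp)+
    have "qprod 2 (3 * Suc M) * qprod 3 (Suc M) = (qprod 2 (3 * M) * qprod 3 M) *
        ((1 - fps_X ^ 2 * y ^ 2) * (1 - fps_X ^ 4 * y ^ 2) * (1 - fps_X ^ 6 * y ^ 2) * (1 - fps_X ^ 3 * y))"
      unfolding 2 by (simp only: ac_simps)
    also have "\<dots> = qprod 1 (3 * Suc M) * qprod 6 (Suc M) * (P * ((1 + fps_X * y) * (1 + fps_X ^ 2 * y)))"
      unfolding Suc[symmetric] 2 P_def[symmetric] by algebra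
    finally show ?case by (simp add: P_def y_def)
  qed simp
  have "is_theta (fprod 2 * fprod 3 ^ 2 * inverse (fprod 1 * fprod 6)) (fps_const 1 * fps_X ^ 1) (fps_const 1 * fps_X ^ 2)"
  proof (rule is_theta_quotientI[where d = 3])
    fix N M :: nat assume "N \<le> M"
    then have c: "cong_upto N (fprod 2) (qprod 2 (3 * M))" "cong_upto N (fprod 3) (qprod 3 M)"
      "cong_upto N (qprod 1 (3 * M)) (fprod 1)" "cong_upto N (qprod 6 M) (fprod 6)"
      by (intro cong_upto_sym[OF fprod_cong] fprod_cong; simp)+
    have "cong_upto N (fprod 3 * (fprod 2 * fprod 3)) (fprod 3 * (qprod 2 (3 * M) * qprod 3 M))"
      by (intro cong_upto_mult c cong_upto_refl)
    also have "cong_upto N \<dots> (fprod 3 * (fprod 1 * fprod 6 * (\<Prod>j<M. (1 + fps_X * fps_X ^ (3 * j)) * (1 + fps_X ^ 2 * fps_X ^ (3 * j)))))"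
      unfolding fin[symmetric] by (intro cong_upto_mult c cong_upto_refl)
    finally show "cong_upto N (fprod 2 * fprod 3 ^ 2) (fprod 1 * fprod 6 * (fprod 3 * (\<Prod>j<M.
        (1 + fps_const 1 * fps_X ^ 1 * fps_X ^ (3 * j)) * (1 + fps_const 1 * fps_X ^ 2 * fps_X ^ (3 * j)))))"
      by (simp add: power2_eq_square ac_simps)
  qed simp_all
  then show ?thesis by simp
qed

text \<open>Removing from \<open>f_1\<close> the even factors and the multiples of 3 leaves the
  residues 1 and 5 modulo 6. Multiples of 6 are removed twice, hence the compensating
  \<open>f_6\<close>.\<close>

lemma is_theta_Omega:
  "is_theta (fprod 1 * fprod 6 ^ 2 * inverse (fprod 2 * fprod 3)) (- fps_X) (- (fps_X ^ 5))"
proof -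
  have fin: "qprod 2 (3 * M) * qprod 3 (2 * M) * (\<Prod>j<M. (1 - fps_X * fps_X ^ (6 * j)) * (1 - fps_X ^ 5 * fps_X ^ (6 * j))) =
    qprod 1 (6 * M) * qprod 6 M" for M
  proof (induction M)
    case (Suc M)
    define y :: "rat fps" where "y = fps_X ^ (6 * M)"
    define P where "P = (\<Prod>j<M. (1 - fps_X * fps_X ^ (6 * j)) * (1 - fps_X ^ 5 * fps_X ^ (6 * j)) :: rat fps)"
    have 1: "2 * Suc M = Suc (Suc (2 * M))" "3 * Suc M = Suc (Suc (Suc (3 * M)))"
      "6 * Suc M = Suc (Suc (Suc (Suc (Suc (Suc (6 * M))))))" by simp_all
    have e: "fps_X ^ n = fps_X * y" if "n = 1 + 6 * M" for n
      unfolding that power_add y_def by simp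
    have e': "fps_X ^ n = fps_X ^ a * y" if "n = a + 6 * M" for n a
      unfolding that power_add y_def ..
    have 2: "qprod 2 (3 * Suc M) = qprod 2 (3 * M) * (1 - fps_X ^ 2 * y) * (1 - fps_X ^ 4 * y) * (1 - fps_X ^ 6 * y)"
      "qprod 3 (2 * Suc M) = qprod 3 (2 * M) * (1 - fps_X ^ 3 * y) * (1 - fps_X ^ 6 * y)"
      "qprod 1 (6 * Suc M) = qprod 1 (6 * M) * (1 - fps_X * y) * (1 - fps_X ^ 2 * y) * (1 - fps_X ^ 3 * y)
         * (1 - fps_X ^ 4 * y) * (1 - fps_X ^ 5 * y) * (1 - fps_X ^ 6 * y)"
      "qprod 6 (Suc M) = qprod 6 M * (1 - fps_X ^ 6 * y)"
      unfolding 1 qprod_Suc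
      by (intro arg_cong2[where f = "(*)"] arg_cong2[where f = "(-)"] refl e e'; simp)+
    have "qprod 1 (6 * Suc M) * qprod 6 (Suc M) = (qprod 1 (6 * M) * qprod 6 M) *
        ((1 - fps_X * y) * (1 - fps_X ^ 2 * y) * (1 - fps_X ^ 3 * y)
         * (1 - fps_X ^ 4 * y) * (1 - fps_X ^ 5 * y) * (1 - fps_X ^ 6 * y) * (1 - fps_X ^ 6 * y))"
      unfolding 2 by (simp only: ac_simps)
    also have "\<dots> = qprod 2 (3 * Suc M) * qprod 3 (2 * Suc M) * (P * ((1 - fps_X * y) * (1 - fps_X ^ 5 * y)))"
      unfolding Suc[symmetric] 2 P_def[symmetric] by (simp only: ac_simps)
    finally show ?case by (simp add: P_def y_def)
  qed simp
  have "is_theta (fprod 1 * fprod 6 ^ 2 * inverse (fprod 2 * fprod 3)) (fps_const (-1) * fps_X ^ 1) (fps_const (-1) * fps_X ^ 5)"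
  proof (rule is_theta_quotientI[where d = 6])
    fix N M :: nat assume "N \<le> M"
    then have c: "cong_upto N (fprod 1) (qprod 1 (6 * M))" "cong_upto N (fprod 6) (qprod 6 M)"
      "cong_upto N (qprod 2 (3 * M)) (fprod 2)" "cong_upto N (qprod 3 (2 * M)) (fprod 3)"
      by (intro cong_upto_sym[OF fprod_cong] fprod_cong; simp)+
    have "cong_upto N (fprod 6 * (fprod 1 * fprod 6)) (fprod 6 * (qprod 1 (6 * M) * qprod 6 M))"
      by (intro cong_upto_mult c cong_upto_refl)
    also have "cong_upto N \<dots> (fprod 6 * (fprod 2 * fprod 3 * (\<Prod>j<M. (1 - fps_X * fps_X ^ (6 * j)) * (1 - fps_X ^ 5 * fps_X ^ (6 * j)))))"
      unfolding fin[symmetric] by (intro cong_upto_mult c cong_upto_refl)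
    finally show "cong_upto N (fprod 1 * fprod 6 ^ 2) (fprod 2 * fprod 3 * (fprod 6 * (\<Prod>j<M.
        (1 + fps_const (-1) * fps_X ^ 1 * fps_X ^ (6 * j)) * (1 + fps_const (-1) * fps_X ^ 5 * fps_X ^ (6 * j)))))"
      by (simp add: power2_eq_square ac_simps flip: fps_const_neg)
  qed simp_all
  then show ?thesis by (simp flip: fps_const_neg)
qed

section \<open>Substitution of \<open>q^3\<close> and assembly of the dissection\<close>

lemma fprod_compose_numeral [simp]:
  "fprod (Suc 0) oo fps_X ^ numeral j = fprod (numeral j)"
  "fprod (numeral k) oo fps_X ^ numeral j = fprod (numeral j * numeral k)"
  by (simp_all add: fprod_compose)

lemma eq_times_inverse:
  fixes f g h :: "'a::field fps"
  assumes "fps_nth h 0 \<noteq> 0"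
  shows "f * inverse h = g \<longleftrightarrow> f = g * h"
  using assms by (metis inverse_mult_eq_1 inverse_mult_eq_1' mult.assoc mult.right_neutral)

abbreviation tri :: "rat fps \<Rightarrow> rat fps" where
  "tri f \<equiv> f oo fps_X ^ 3"

lemma X3_nth_0: "fps_nth (fps_X ^ 3 :: rat fps) 0 = 0"
  by simp

lemma tri_mult: "tri (f * g) = tri f * tri g"
  by (rule fps_compose_mult_distrib[OF X3_nth_0])

lemma tri_power: "tri (f ^ n) = tri f ^ n"
  by (rule fps_compose_power[OF X3_nth_0, symmetric])

lemma tri_X: "tri fps_X = fps_X ^ 3"
  by (rule fps_X_fps_compose_startby0[OF X3_nth_0])

lemmas tri_simps = tri_mult tri_power tri_X fps_compose_add_distrib
  fps_compose_sub_distrib fps_compose_uminus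

text \<open>Multiply the trisections of \<open>phi(-q)\<close> and \<open>2 psi(q)\<close>, whose
  product is \<open>2 f_1 f_2\<close>. Each has only two terms, and the cross terms collapse because
  \<open>phi3 * psi3\<close> and \<open>A * \<Omega>\<close> are both multiples of
  \<open>D\<close>.\<close>

lemma dissection_F:
  obtains a c where
    "fprod 1 * fprod 2 = fprod 9 * fprod 18 * (tri a - fps_X + fps_X ^ 2 * tri c)" "a * c = - 2"
proof -
  define phi where "phi = fprod 1 ^ 2 * inverse (fprod 2)"
  define psi where "psi = 2 * fprod 2 ^ 2 * inverse (fprod 1)"
  define A where "A = fprod 2 * fprod 3 ^ 2 * inverse (fprod 1 * fprod 6)"
  define \<Omega> where "\<Omega> = fprod 1 * fprod 6 ^ 2 * inverse (fprod 2 * fprod 3)"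
  define D where "D = fprod 3 * fprod 6"
  have D0: "fps_nth D 0 = 1" by (simp add: D_def)
  note th = is_theta_phi[folded phi_def] is_theta_psi[folded psi_def] is_theta_A[folded A_def]
    is_theta_Omega[folded \<Omega>_def]
  have X: "fps_nth (fps_X ^ n :: rat fps) 0 = 0" if "0 < n" for n using that by simp
  have X_oo [simp]: "fps_X oo fps_X ^ n = (fps_X ^ n :: rat fps)" if "0 < n" for n
    by (rule fps_X_fps_compose_startby0[OF X[OF that]])
  have Xp_oo [simp]: "fps_X ^ m oo fps_X ^ n = (fps_X ^ (n * m) :: rat fps)" if "0 < n" for m n
    by (simp add: fps_X_power_compose[OF X[OF that]] power_mult)
  \<comment> \<open>With both arguments equal to \<open>- fps_X\<close>, the classes of 1 and -1
    modulo 3 give the same series.\<close>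
  have "phi = (phi oo fps_X ^ 9) + - fps_X * tri \<Omega> + - fps_X * tri \<Omega>"
  proof (rule theta_dissection_3[OF th(1)])
    show "is_theta (phi oo fps_X ^ 9) ((- fps_X) ^ 6 * (- fps_X) ^ 3) ((- fps_X) ^ 3 * (- fps_X) ^ 6)"
      using is_theta_compose[OF th(1), of 9] by (simp add: fps_compose_uminus flip: power_add)
    have "is_theta (tri \<Omega>) (- (fps_X ^ 3)) (- (fps_X ^ 15))"
      using is_theta_compose[OF th(4), of 3] by (simp add: fps_compose_uminus)
    then show "is_theta (tri \<Omega>) ((- fps_X) ^ 9 * (- fps_X) ^ 6) ((- fps_X) ^ 3)"
      and "is_theta (tri \<Omega>) ((- fps_X) ^ 3) ((- fps_X) ^ 6 * (- fps_X) ^ 9)"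
      by (simp_all add: is_theta_commute flip: power_add)
  qed
  then have phi: "phi = (phi oo fps_X ^ 9) - 2 * fps_X * tri \<Omega>" by (simp add: mult.assoc)
  \<comment> \<open>With first argument 1, the classes of 0 and 1 modulo 3 give the same series, and
    the class of -1 reproduces \<open>psi\<close> at \<open>q^9\<close>.\<close>
  have "psi = tri A + 1 * tri A + fps_X * (psi oo fps_X ^ 9)"
  proof (rule theta_dissection_3[OF th(2)])
    have "is_theta (tri A) (fps_X ^ 3) (fps_X ^ 6)"
      using is_theta_compose[OF th(3), of 3] by simp
    then show "is_theta (tri A) (1 ^ 6 * fps_X ^ 3) (1 ^ 3 * fps_X ^ 6)"
      and "is_theta (tri A) (1 ^ 9 * fps_X ^ 6) (fps_X ^ 3)"
      by (simp_all add: is_theta_commute)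
    show "is_theta (psi oo fps_X ^ 9) (1 ^ 3) (1 ^ 6 * fps_X ^ 9)"
      using is_theta_compose[OF th(2), of 9] by simp
  qed
  then have psi: "psi = 2 * tri A + fps_X * (psi oo fps_X ^ 9)" by simp
  define phi3 where "phi3 = phi oo fps_X ^ 3"
  define psi3 where "psi3 = psi oo fps_X ^ 3"
  have nine: "phi oo fps_X ^ 9 = tri phi3" "psi oo fps_X ^ 9 = tri psi3"
    using fps_compose_assoc[OF X3_nth_0 X3_nth_0] by (simp_all add: phi3_def psi3_def)
  have i: "f * inverse (fprod k) * fprod k = f" for f k
    by (simp add: mult.assoc inverse_mult_eq_1)
  have "phi * fprod 2 * (psi * fprod 1) = 2 * (fprod 1 * fprod 2) * (fprod 1 * fprod 2)"
    unfolding phi_def psi_def i by (simp add: power2_eq_square)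
  then have "(phi * psi) * (fprod 1 * fprod 2) = 2 * (fprod 1 * fprod 2) * (fprod 1 * fprod 2)"
    by (simp only: ac_simps)
  moreover have "fprod 1 * fprod 2 \<noteq> 0" by simp
  ultimately have pp: "phi * psi = 2 * (fprod 1 * fprod 2)"
    by (metis mult_right_cancel)
  have "phi3 * psi3 = tri (phi * psi)" by (simp only: phi3_def psi3_def tri_mult)
  also have "\<dots> = 2 * D" unfolding pp by (simp add: tri_mult D_def)
  finally have pp3: "phi3 * psi3 = 2 * D" .
  have AO: "A * \<Omega> = D"
  proof -
    have "A * \<Omega> = (fprod 2 * fprod 3 ^ 2 * (fprod 1 * fprod 6 ^ 2)) * inverse (fprod 1 * fprod 6 * (fprod 2 * fprod 3))"
      by (simp add: A_def \<Omega>_def fps_inverse_mult ac_simps)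
    also have "\<dots> = D"
      by (subst eq_times_inverse) (simp_all add: D_def power2_eq_square ac_simps)
    finally show ?thesis .
  qed
  \<comment> \<open>The outer coefficients of the product, divided by \<open>2 * D\<close>; the sign
    of \<open>c\<close> comes from \<open>phi\<close>.\<close>
  define a where "a = phi3 * A * inverse D"
  define c where "c = - (\<Omega> * psi3 * inverse D)"
  have "a * c = - ((phi3 * psi3) * (A * \<Omega>) * inverse D * inverse D)"
    by (simp add: a_def c_def ac_simps)
  also have "\<dots> = - 2"
    using D0 by (simp add: pp3 AO mult.assoc inverse_mult_eq_1 inverse_mult_eq_1')
  finally have ac: "a * c = - 2" .
  have aD: "phi3 * A = D * a" "\<Omega> * psi3 = - (D * c)"
    using D0 by (simp_all add: a_def c_def ac_simps inverse_mult_eq_1')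
  have "2 * (fprod 1 * fprod 2) = (tri phi3 - 2 * fps_X * tri \<Omega>) * (2 * tri A + fps_X * tri psi3)"
    using pp phi psi unfolding nine by simp
  \<comment> \<open>The coefficient of \<open>fps_X\<close> is \<open>2 - 4 = -2\<close> times
    \<open>tri D\<close>, which gives the \<open>- fps_X\<close> of the claim after halving.\<close>
  also have "\<dots> = 2 * tri (phi3 * A) + fps_X * (tri (phi3 * psi3) - 4 * tri (A * \<Omega>)) - 2 * fps_X ^ 2 * tri (\<Omega> * psi3)"
    by (simp add: tri_mult algebra_simps power2_eq_square)
  also have "\<dots> = 2 * (tri D * (tri a - fps_X + fps_X ^ 2 * tri c))"
    unfolding aD pp3 AO by (simp add: tri_mult fps_compose_uminus algebra_simps)
  also have "tri D = fprod 9 * fprod 18" by (simp add: D_def tri_mult)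
  finally have "fprod 1 * fprod 2 = fprod 9 * fprod 18 * (tri a - fps_X + fps_X ^ 2 * tri c)" by simp
  then show thesis using ac that by blast
qed

section \<open>Sections modulo 3 and the cubic equation\<close>

definition sec :: "nat \<Rightarrow> rat fps \<Rightarrow> rat fps" where
  "sec r f = Abs_fps (\<lambda>n. fps_nth f (3 * n + r))"

lemma sec_nth [simp]: "fps_nth (sec r f) n = fps_nth f (3 * n + r)"
  by (simp add: sec_def)

lemma sec_add: "sec r (f + g) = sec r f + sec r g"
  by (simp add: fps_eq_iff)

lemma sec_sum: "sec r (sum f S) = (\<Sum>x\<in>S. sec r (f x))"
  by (simp add: fps_eq_iff fps_sum_nth)

lemma sec_const_mult: "sec r (fps_const c * f) = fps_const c * sec r f"
  by (simp add: fps_eq_iff)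

lemma sec_combination:
  "sec 0 (tri a + fps_X * tri b + fps_X ^ 2 * tri c) = a"
  "sec 1 (tri a + fps_X * tri b + fps_X ^ 2 * tri c) = b"
  "sec 2 (tri a + fps_X * tri b + fps_X ^ 2 * tri c) = c"
proof -
  have [simp]: "Suc (3 * n) div 3 = n" "Suc (Suc (3 * n)) div 3 = n"
    "\<not> 3 dvd Suc (3 * n)" "\<not> 3 dvd Suc (Suc (3 * n))" for n :: nat
    by presburger+
  show "sec 0 (tri a + fps_X * tri b + fps_X ^ 2 * tri c) = a"
    by (auto simp: fps_eq_iff fps_nth_compose_X_power fps_X_power_mult_nth) presburger+
  show "sec 1 (tri a + fps_X * tri b + fps_X ^ 2 * tri c) = b"
    by (auto simp: fps_eq_iff fps_nth_compose_X_power fps_X_power_mult_nth) presburger+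
  show "sec 2 (tri a + fps_X * tri b + fps_X ^ 2 * tri c) = c"
    by (auto simp: fps_eq_iff fps_nth_compose_X_power fps_X_power_mult_nth)
qed

lemma sec_decomposition: "f = tri (sec 0 f) + fps_X * tri (sec 1 f) + fps_X ^ 2 * tri (sec 2 f)" (is "_ = ?g")
proof (rule fps_ext)
  fix n :: nat
  define r where "r = n mod 3"
  have "r < 3" by (simp add: r_def)
  then have "r = 0 \<or> r = 1 \<or> r = 2" by linarith
  then have "sec r f = sec r ?g" using sec_combination by metis
  then have "fps_nth (sec r f) (n div 3) = fps_nth (sec r ?g) (n div 3)" by simp
  moreover have "3 * (n div 3) + r = n" by (simp add: r_def)
  ultimately show "fps_nth f n = fps_nth ?g n" by (simp only: sec_nth)
qed

lemma sec_eqI: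
  assumes "f = tri a + fps_X * tri b + fps_X ^ 2 * tri c"
  shows "sec 0 f = a" "sec 1 f = b" "sec 2 f = c"
  unfolding assms by (rule sec_combination)+

lemma sec_tri_mult: "sec 0 (tri g * f) = g * sec 0 f"
  by (rule sec_eqI[where b = "g * sec 1 f" and c = "g * sec 2 f"], subst sec_decomposition[of f])
    (simp only: tri_mult distrib_left ac_simps)

text \<open>Residues adding up to 3 or 4 carry a factor \<open>q^3\<close>, which turns into
  \<open>fps_X\<close> in the section.\<close>

lemma sec_mult:
  "sec 0 (f * g) = sec 0 f * sec 0 g + fps_X * (sec 1 f * sec 2 g + sec 2 f * sec 1 g)" (is "_ = ?a")
  "sec 1 (f * g) = sec 0 f * sec 1 g + sec 1 f * sec 0 g + fps_X * (sec 2 f * sec 2 g)" (is "_ = ?b")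
  "sec 2 (f * g) = sec 0 f * sec 2 g + sec 1 f * sec 1 g + sec 2 f * sec 0 g" (is "_ = ?c")
proof -
  have "f * g = (tri (sec 0 f) + fps_X * tri (sec 1 f) + fps_X ^ 2 * tri (sec 2 f)) *
     (tri (sec 0 g) + fps_X * tri (sec 1 g) + fps_X ^ 2 * tri (sec 2 g))"
    by (simp only: sec_decomposition[symmetric])
  also have "\<dots> = tri ?a + fps_X * tri ?b + fps_X ^ 2 * tri ?c"
    unfolding tri_simps by algebra
  finally show "sec 0 (f * g) = ?a" "sec 1 (f * g) = ?b" "sec 2 (f * g) = ?c"
    by (fact sec_eqI)+
qed

text \<open>With \<open>\<omega>\<close> a primitive cube root of unity, this is the series \<open>h\<close> with
  \<open>h(q^3) = f(q) f(\<omega> q) f(\<omega>^2 q)\<close>.\<close>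
definition norm3 :: "rat fps \<Rightarrow> rat fps" where
  "norm3 f = sec 0 f ^ 3 + fps_X * sec 1 f ^ 3 + fps_X ^ 2 * sec 2 f ^ 3
     - 3 * fps_X * (sec 0 f * sec 1 f * sec 2 f)"

text \<open>In terms of the sections this is a polynomial identity, so no cube root of unity has to
  be adjoined to \<open>rat\<close>.\<close>

lemma norm3_mult: "norm3 (f * g) = norm3 f * norm3 g"
  unfolding norm3_def sec_mult by algebra

lemma norm3_combination:
  "norm3 (tri a + fps_X * tri b + fps_X ^ 2 * tri c) =
     a ^ 3 + fps_X * b ^ 3 + fps_X ^ 2 * c ^ 3 - 3 * fps_X * (a * b * c)"
  by (simp only: norm3_def sec_combination)

lemma norm3_tri: "norm3 (tri a) = a ^ 3"
  using norm3_combination[of a 0 0] by simp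

text \<open>If 3 divides the exponent, the three conjugate factors coincide. Otherwise they multiply
  to \<open>1 - q^(3 e)\<close>, which the passage from \<open>q^3\<close> to \<open>q\<close> turns
  back into \<open>1 - q^e\<close>.\<close>

lemma norm3_one_minus_X_power:
  shows "norm3 (1 - fps_X ^ (3 * l)) = (1 - fps_X ^ l) ^ 3"
    and "\<not> 3 dvd e \<Longrightarrow> norm3 (1 - fps_X ^ e) = 1 - fps_X ^ e"
proof -
  have t: "tri (fps_X ^ l) = fps_X ^ (3 * l)" for l
    unfolding tri_power tri_X by (rule power_mult[symmetric])
  show "norm3 (1 - fps_X ^ (3 * l)) = (1 - fps_X ^ l) ^ 3"
    using norm3_tri[of "1 - fps_X ^ l"] by (simp only: fps_compose_sub_distrib fps_compose_1 t)
  assume e: "\<not> 3 dvd e"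
  define l where "l = e div 3"
  from e have "e = 3 * l + 1 \<or> e = 3 * l + 2" unfolding l_def by presburger
  then show "norm3 (1 - fps_X ^ e) = 1 - fps_X ^ e"
  proof
    assume e: "e = 3 * l + 1"
    have "1 - fps_X ^ e = tri 1 + fps_X * tri (- (fps_X ^ l)) + fps_X ^ 2 * tri 0"
      by (simp only: e power_add t fps_compose_uminus) simp
    from arg_cong[OF this, of norm3] show ?thesis
      unfolding norm3_combination by (simp add: e mult.commute flip: power_mult)
  next
    assume e: "e = 3 * l + 2"
    have "1 - fps_X ^ e = tri 1 + fps_X * tri 0 + fps_X ^ 2 * tri (- (fps_X ^ l))"
      by (simp only: e power_add t fps_compose_uminus) simp
    from arg_cong[OF this, of norm3] show ?thesis
      unfolding norm3_combination
      by (simp add: e power_add power2_eq_square mult.commute flip: power_mult)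
  qed
qed

lemma norm3_cong:
  assumes "cong_upto (3 * N) f g"
  shows "cong_upto N (norm3 f) (norm3 g)"
proof -
  have c: "cong_upto N (sec r f) (sec r g)" if "r < 3" for r
    using assms that by (simp add: cong_upto_def)
  have e: "norm3 f = sec 0 f ^ 3 + fps_X * sec 1 f ^ 3 + fps_X ^ 2 * sec 2 f ^ 3
     + (- 3 * fps_X) * (sec 0 f * sec 1 f * sec 2 f)" for f
    by (simp add: norm3_def)
  show ?thesis
    unfolding e by (intro cong_upto_add cong_upto_mult cong_upto_power cong_upto_refl c) simp_all
qed

text \<open>Factors with \<open>m\<close> a multiple of 3 contribute \<open>qprod k n ^ 3\<close>;
  the others are fixed by the norm and make up \<open>qprod k (3 * n)\<close> without its part
  \<open>qprod (3 * k) n\<close>.\<close>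

lemma norm3_qprod:
  assumes "\<not> 3 dvd k"
  shows "norm3 (qprod k (3 * n)) * qprod (3 * k) n = qprod k (3 * n) * qprod k n ^ 3"
proof (induction n)
  case 0
  show ?case using norm3_one_minus_X_power(1)[of 0] norm3_tri[of 1] by simp
next
  case (Suc n)
  have 1: "3 * Suc n = Suc (Suc (Suc (3 * n)))" and 2: "k * Suc (Suc (Suc (3 * n))) = 3 * (k * Suc n)"
    "3 * k * Suc n = 3 * (k * Suc n)"
    by simp_all
  have "\<not> 3 dvd k * Suc (3 * n)" "\<not> 3 dvd k * Suc (Suc (3 * n))"
  proof -
    have "k * Suc (3 * n) = k + 3 * (k * n)" "k * Suc (Suc (3 * n)) = 2 * k + 3 * (k * n)"
      by simp_all
    moreover have "\<not> 3 dvd 2 * k" using assms by presburger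
    ultimately show "\<not> 3 dvd k * Suc (3 * n)" "\<not> 3 dvd k * Suc (Suc (3 * n))"
      using assms by (simp_all only: dvd_add_left_iff[OF dvd_triv_left] not_False_eq_True)
  qed
  note n = norm3_one_minus_X_power(2)[OF this(1)] norm3_one_minus_X_power(2)[OF this(2)]
  have alg: "nP * S = P * Q ^ 3 \<Longrightarrow> nP * a * b * c ^ 3 * (S * d) = P * a * b * d * (Q * c) ^ 3"
    for nP S P Q a b c d :: "rat fps"
    by algebra
  show ?case
    unfolding 1 qprod_Suc norm3_mult n 2 norm3_one_minus_X_power(1)
    by (rule alg) (rule Suc)
qed

lemma norm3_fprod:
  assumes "\<not> 3 dvd k" "1 \<le> k"
  shows "norm3 (fprod k) * fprod (3 * k) = fprod k ^ 4"
proof (rule fps_eqI_cong_upto)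
  fix N
  have c: "cong_upto N (fprod (3 * k)) (qprod (3 * k) N)" "cong_upto N (qprod k N) (fprod k)"
    "cong_upto N (qprod k (3 * N)) (fprod k)" "cong_upto (3 * N) (fprod k) (qprod k (3 * N))"
    using assms by (intro cong_upto_sym[OF fprod_cong] fprod_cong; simp)+
  have "cong_upto N (norm3 (fprod k) * fprod (3 * k)) (norm3 (qprod k (3 * N)) * qprod (3 * k) N)"
    by (intro cong_upto_mult norm3_cong c)
  also have "cong_upto N \<dots> (fprod k * fprod k ^ 3)"
    unfolding norm3_qprod[OF assms(1)] by (intro cong_upto_mult cong_upto_power c)
  also have "fprod k * fprod k ^ 3 = fprod k ^ 4"
    by (simp add: power_Suc[symmetric] del: power_Suc)
  finally show "cong_upto N (norm3 (fprod k) * fprod (3 * k)) (fprod k ^ 4)" .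
qed

section \<open>The series zeta and its cubic equation\<close>

lemma G_mult: "G * (fprod 1 * fprod 2) = fprod 3 * fprod 6"
  by (simp add: G_def mult.assoc inverse_mult_eq_1)

lemma G_nonzero [simp]: "G \<noteq> 0"
  using G_mult by force

text \<open>Equal to \<open>q f_9 f_18 / (f_1 f_2)\<close>, as \<open>f_3 f_6\<close> cancels
  between \<open>G\<close> and \<open>tri G\<close>.\<close>

definition zeta :: "rat fps" where
  "zeta = fps_X * G * tri G"

text \<open>With \<open>w\<close> the bracket of the dissection, \<open>zeta * w = fps_X\<close>.
  The norm of \<open>w\<close> is a cubic polynomial in \<open>w\<close> at \<open>q^3\<close>, and
  it is also \<open>1 / G^4\<close>; multiplying by powers of \<open>zeta\<close> yields all three
  relations.\<close>

lemma zeta_relations: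
  shows zeta_cubic: "zeta ^ 3 = tri (fps_X * G ^ 4) * (1 + 3 * zeta + 9 * zeta ^ 2)"
    and sec_zeta: "sec 0 zeta = 3 * (fps_X * G ^ 4)"
    and sec_zeta_square: "sec 0 (zeta ^ 2) = 2 * (fps_X * G ^ 4) + 27 * (fps_X * G ^ 4) ^ 2"
proof -
  define F where "F = fprod 1 * fprod 2"
  define E where "E = fprod 3 * fprod 6"
  obtain a c where "fprod 1 * fprod 2 = fprod 9 * fprod 18 * (tri a - fps_X + fps_X ^ 2 * tri c)"
    and ac: "a * c = - 2" by (rule dissection_F)
  moreover define w where "w = tri a - fps_X + fps_X ^ 2 * tri c"
  ultimately have Fw: "F = tri E * w" by (simp add: F_def E_def tri_mult)
  have EF: "E = tri F" by (simp add: E_def F_def tri_mult)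
  have F0: "F \<noteq> 0" by (simp add: F_def)
  have GF: "G * F = E" unfolding E_def F_def by (rule G_mult)
  then have GE: "tri G * E = tri E" unfolding EF by (simp only: tri_mult[symmetric])
  have "G * tri G * w * F = F"
    using Fw GE GF by (metis mult.assoc mult.commute)
  then have Gw: "G * tri G * w = 1" using F0 by simp
  then have zw: "zeta * w = fps_X" unfolding zeta_def by (metis mult.assoc mult.right_neutral)
  define n where "n = a ^ 3 - 7 * fps_X + fps_X ^ 2 * c ^ 3"
  have "norm3 w = a ^ 3 + fps_X * (-1) ^ 3 + fps_X ^ 2 * c ^ 3 - 3 * fps_X * (a * (-1) * c)"
    using norm3_combination[of a "-1" c] by (simp add: w_def fps_compose_uminus)
  \<comment> \<open>The middle coefficient is \<open>-1 + 3 * a * c = -7\<close>.\<close>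
  also have "\<dots> = n" unfolding n_def using ac by algebra
  finally have norm_w: "norm3 w = n" .
  have "norm3 F * E = (norm3 (fprod 1) * fprod (3 * 1)) * (norm3 (fprod 2) * fprod (3 * 2))"
    by (simp add: F_def E_def norm3_mult)
  also have "\<dots> = F ^ 4" by (subst (1 2) norm3_fprod) (simp_all add: F_def power_mult_distrib)
  finally have "E ^ 3 * n * E = F ^ 4" unfolding Fw norm3_mult norm_w norm3_tri .
  then have "(G ^ 4 * n) * F ^ 4 = 1 * F ^ 4" unfolding GF[symmetric] by algebra
  then have Gn: "G ^ 4 * n = 1" using F0 by (metis mult_right_cancel power_not_zero)
  then have "tri (G ^ 4 * n) = tri 1" by simp
  then have tGn: "tri G ^ 4 * tri n = 1" by (simp add: tri_mult tri_power)
  have tac: "tri a * tri c = - 2" using arg_cong[OF ac, of tri] by (simp add: tri_mult fps_compose_uminus)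
  \<comment> \<open>Cube \<open>w + fps_X = tri a + fps_X ^ 2 * tri c\<close> and replace
    \<open>tri a * tri c\<close> by -2.\<close>
  have tn: "tri n = w ^ 3 + 3 * fps_X * w ^ 2 + 9 * fps_X ^ 2 * w"
    unfolding n_def w_def tri_simps numeral_compose using tac by algebra
  have z: "zeta ^ m * tri n * tri G ^ 4 = zeta ^ m" for m
    using tGn by (simp add: mult.assoc mult.commute)
  have "zeta ^ 3 * tri n * tri G ^ 4 = tri (fps_X * G ^ 4) * (1 + 3 * zeta + 9 * zeta ^ 2)"
  proof -
    have "zeta ^ 3 * tri n * tri G ^ 4 =
      ((zeta * w) ^ 3 + 3 * fps_X * (zeta * w) ^ 2 * zeta + 9 * fps_X ^ 2 * (zeta * w) * zeta ^ 2) * tri G ^ 4"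
      unfolding tn by algebra
    then show ?thesis unfolding zw tri_simps by algebra
  qed
  then show "zeta ^ 3 = tri (fps_X * G ^ 4) * (1 + 3 * zeta + 9 * zeta ^ 2)" unfolding z .
  have "zeta ^ 1 * tri n * tri G ^ 4 =
      tri (G ^ 4) * (tri (3 * fps_X) + fps_X * tri (a ^ 2 + fps_X * c) + fps_X ^ 2 * tri (a + fps_X * c ^ 2))"
  proof -
    have "zeta ^ 1 * tri n * tri G ^ 4 = tri G ^ 4 * (fps_X * (w ^ 2 + 3 * fps_X * w + 9 * fps_X ^ 2))"
    proof -
      have "zeta ^ 1 * tri n * tri G ^ 4 =
          (zeta * w) * (w ^ 2 + 3 * fps_X * w + 9 * fps_X ^ 2) * tri G ^ 4"
        unfolding tn by algebra
      then show ?thesis unfolding zw by algebra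
    qed
    \<comment> \<open>Expanding sorts the terms by residue; the coefficient of
      \<open>fps_X ^ 3\<close> is \<open>1 - 4 - 3 + 9 = 3\<close>.\<close>
    also have "fps_X * (w ^ 2 + 3 * fps_X * w + 9 * fps_X ^ 2) =
        tri (3 * fps_X) + fps_X * tri (a ^ 2 + fps_X * c) + fps_X ^ 2 * tri (a + fps_X * c ^ 2)"
      unfolding w_def tri_simps numeral_compose using tac by algebra
    finally show ?thesis by (simp only: tri_power)
  qed
  from arg_cong[OF this, of "sec 0"] show s: "sec 0 zeta = 3 * (fps_X * G ^ 4)"
    unfolding z sec_tri_mult sec_combination by (simp add: ac_simps)
  have "zeta ^ 2 * tri n * tri G ^ 4 =
      tri (G ^ 4) * ((tri (2 * fps_X) + fps_X * tri (fps_X * c) + fps_X ^ 2 * tri a) + tri (9 * fps_X) * zeta)"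
  proof -
    have "zeta ^ 2 * tri n * tri G ^ 4 = tri G ^ 4 * ((fps_X ^ 2 * w + 3 * fps_X ^ 3) + 9 * fps_X ^ 3 * zeta)"
    proof -
      have "zeta ^ 2 * tri n * tri G ^ 4 =
          ((zeta * w) ^ 2 * w + 3 * fps_X * (zeta * w) ^ 2 + 9 * fps_X ^ 2 * (zeta * w) * zeta) * tri G ^ 4"
        unfolding tn by algebra
      then show ?thesis unfolding zw by algebra
    qed
    also have "fps_X ^ 2 * w + 3 * fps_X ^ 3 = tri (2 * fps_X) + fps_X * tri (fps_X * c) + fps_X ^ 2 * tri a"
      unfolding w_def tri_simps numeral_compose by algebra
    finally show ?thesis by (simp only: tri_simps numeral_compose)
  qed
  from arg_cong[OF this, of "sec 0"]
  show "sec 0 (zeta ^ 2) = 2 * (fps_X * G ^ 4) + 27 * (fps_X * G ^ 4) ^ 2"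
    unfolding z sec_tri_mult sec_add[of _ _ "tri (9 * fps_X) * zeta"] sec_combination s by algebra
qed

section \<open>Powers of $\zeta$ and the matrices\<close>

declare mm.simps [simp del]

lemma mm_0 [simp]: "mm 0 j = 0" "mm n 0 = 0"
  by (simp_all add: mm.simps)

lemma mm_eq_0: "n < j \<Longrightarrow> mm n j = 0"
  by (simp add: mm.simps)

lemma mm_rec:
  assumes "j < n + 4"
  shows "mm (n + 4) (Suc j) = 9 * mm (n + 3) j + 3 * mm (n + 2) j + mm (n + 1) j"
  using assms by (cases "j = 0")
    (simp_all add: mm.simps[of "n + 4" "Suc j"] mm.simps[of "n + 4" "Suc 0"] add.commute)

lemma mm_1: "mm 1 (Suc 0) = 3"
  and mm_2: "mm 2 (Suc 0) = 2" "mm 2 2 = 27"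
  and mm_3: "mm 3 (Suc 0) = 1" "mm 3 2 = 27" "mm 3 3 = 243"
  by (simp_all add: mm.simps)

text \<open>One recursion step lowers the column by 1 and the row by at most 3. This bounds from
  below the order in \<open>Y\<close> of the section of \<open>zeta ^ n\<close>.\<close>

lemma mm_eq_0': "3 * j < n \<Longrightarrow> mm n j = 0"
proof (induction n arbitrary: j rule: less_induct)
  case (less n)
  show ?case
  proof (cases "j = 0 \<or> n < 4")
    case True
    with less.prems have "j = 0" by auto
    then show ?thesis by simp
  next
    case False
    then obtain i m where i: "j = Suc i" "n = m + 4"
      by (metis add.commute le_Suc_ex not_less not0_implies_Suc)
    with less show ?thesis by (simp add: mm_rec)
  qed
qed

definition mm_sum :: "nat \<Rightarrow> rat fps \<Rightarrow> rat fps" where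
  "mm_sum n Y = (\<Sum>j\<le>n. of_int (mm n j) * Y ^ j)"

lemma mm_sum_small:
  "mm_sum (Suc 0) Y = 3 * Y" "mm_sum 2 Y = 2 * Y + 27 * Y ^ 2" "mm_sum 3 Y = Y + 27 * Y ^ 2 + 243 * Y ^ 3"
proof -
  have [simp]: "{..Suc 0} = {0, 1}" "{..2::nat} = {0, 1, 2}" "{..3::nat} = {0, 1, 2, 3}"
    by auto
  show "mm_sum (Suc 0) Y = 3 * Y" "mm_sum 2 Y = 2 * Y + 27 * Y ^ 2" "mm_sum 3 Y = Y + 27 * Y ^ 2 + 243 * Y ^ 3"
    using mm_1 by (simp_all add: mm_sum_def mm_2 mm_3)
qed

lemma mm_sum_extend: "n \<le> L \<Longrightarrow> (\<Sum>j\<le>L. of_int (mm n j) * Y ^ j) = mm_sum n Y"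
  unfolding mm_sum_def by (rule sum.mono_neutral_right) (auto simp: mm_eq_0)

lemma mm_sum_rec:
  "mm_sum (n + 4) Y = Y * (mm_sum (n + 1) Y + 3 * mm_sum (n + 2) Y + 9 * mm_sum (n + 3) Y)"
proof -
  have "mm_sum (n + 4) Y = (\<Sum>j\<le>Suc (n + 3). of_int (mm (n + 4) j) * Y ^ j)"
    by (simp add: mm_sum_def eval_nat_numeral)
  also have "\<dots> = (\<Sum>j\<le>n + 3. of_int (mm (n + 4) (Suc j)) * Y ^ Suc j)"
    by (subst sum.atMost_Suc_shift) simp
  also have "\<dots> = (\<Sum>j\<le>n + 3. Y * (of_int (mm (n + 1) j) * Y ^ j + 3 * (of_int (mm (n + 2) j) * Y ^ j)
      + 9 * (of_int (mm (n + 3) j) * Y ^ j)))"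
    by (intro sum.cong refl, subst mm_rec) (simp_all add: algebra_simps)
  also have "\<dots> = Y * ((\<Sum>j\<le>n + 3. of_int (mm (n + 1) j) * Y ^ j) + 3 * (\<Sum>j\<le>n + 3. of_int (mm (n + 2) j) * Y ^ j)
      + 9 * (\<Sum>j\<le>n + 3. of_int (mm (n + 3) j) * Y ^ j))"
    by (simp only: sum.distrib flip: sum_distrib_left)
  also have "\<dots> = Y * (mm_sum (n + 1) Y + 3 * mm_sum (n + 2) Y + 9 * mm_sum (n + 3) Y)"
    by (simp add: mm_sum_extend)
  finally show ?thesis .
qed

text \<open>The cubic equation times \<open>zeta ^ m\<close> gives the sections the recurrence of
  the rows of \<open>mm\<close>. For \<open>n = 3\<close> it involves \<open>zeta ^ 0\<close>, whose
  section is 1 while row 0 of \<open>mm\<close> is zero, so this case is a base case.\<close>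

lemma sec_zeta_power: "1 \<le> n \<Longrightarrow> sec 0 (zeta ^ n) = mm_sum n (fps_X * G ^ 4)"
proof (induction n rule: less_induct)
  case (less n)
  define Y where "Y = fps_X * G ^ 4"
  have rec: "sec 0 (zeta ^ (m + 3)) = Y * (sec 0 (zeta ^ m) + 3 * sec 0 (zeta ^ (m + 1)) + 9 * sec 0 (zeta ^ (m + 2)))" for m
  proof -
    have "zeta ^ (m + 3) = tri Y * (zeta ^ m + fps_const 3 * zeta ^ (m + 1) + fps_const 9 * zeta ^ (m + 2))"
      unfolding power_add zeta_cubic[folded Y_def] numeral_fps_const[symmetric] by algebra
    then show ?thesis
      by (simp only: sec_tri_mult sec_add sec_const_mult numeral_fps_const)
  qed
  have sec1: "sec 0 1 = 1"
    using sec_combination(1)[of 1 0 0] by simp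
  have "n = 1 \<or> n = 2 \<or> n = 3 \<or> n = (n - 4) + 4" using less.prems by linarith
  then consider "n = 1" | "n = 2" | "n = 3" | m where "n = m + 4" by blast
  then show ?case
  proof cases
    case 1
    then show ?thesis by (simp add: sec_zeta mm_sum_small)
  next
    case 2
    then show ?thesis by (simp add: sec_zeta_square mm_sum_small)
  next
    case 3
    have "sec 0 (zeta ^ (0 + 3)) = Y * (1 + 3 * (3 * Y) + 9 * (2 * Y + 27 * Y ^ 2))"
      unfolding rec
      by (simp only: add_0 power_0 power_one_right sec1 sec_zeta sec_zeta_square Y_def)
    also have "\<dots> = mm_sum 3 Y" unfolding mm_sum_small by algebra
    finally show ?thesis using 3 by (simp add: Y_def)
  next
    case (4 m)
    have IH: "sec 0 (zeta ^ (m + k)) = mm_sum (m + k) Y" if "k \<in> {1, 2, 3}" for k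
      unfolding Y_def using 4 that by (intro less.IH) auto
    have e: "m + 1 + 1 = m + 2" "m + 1 + 2 = m + 3" "m + 1 + 3 = m + 4" by simp_all
    show ?thesis
      using rec[of "m + 1"] unfolding e 4 mm_sum_rec Y_def[symmetric] by (simp only: IH insertI1 insertI2)
  qed
qed

section \<open>Rows of A and B from powers of zeta\<close>

lemma sec_X_mult: "sec 0 (fps_X * f) = fps_X * sec 2 f"
proof (rule fps_ext)
  fix n show "fps_nth (sec 0 (fps_X * f)) n = fps_nth (fps_X * sec 2 f) n"
    by (cases n) simp_all
qed

text \<open>Cancel the common factor \<open>fps_X ^ i * G ^ n\<close> from the expansion in
  \<open>Y\<close>. The values \<open>e = 3\<close> and \<open>e = 1\<close> belong to
  \<open>A\<close> and \<open>B\<close>; passing from \<open>e\<close> to \<open>4 - e\<close> swaps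
  the two families of exponents of \<open>G\<close>.\<close>

lemma sec_zeta_power_cancel:
  assumes "fps_X ^ i * G ^ n * S = sec 0 (zeta ^ n)" "n + e = 4 * i" "1 \<le> i" "e \<in> {1, 3}"
  shows "S = (\<Sum>k=1..3 * i. of_int (mm n (i + k - 1)) * (fps_X ^ (k - 1) * G ^ (4 * k - (4 - e))))"
    (is "_ = ?T")
proof -
  define Y where "Y = fps_X * G ^ 4"
  have "e \<le> 3" using assms(4) by auto
  with assms(2,3) have "1 \<le> n" by linarith
  then have "fps_X ^ i * G ^ n * S = mm_sum n Y"
    using assms(1) by (simp add: sec_zeta_power Y_def)
  also have "\<dots> = (\<Sum>j\<le>4 * i - 1. of_int (mm n j) * Y ^ j)"
    using assms(2,4) by (intro mm_sum_extend[symmetric]) auto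
  \<comment> \<open>Coefficients with \<open>j < i\<close> vanish, because then
    \<open>3 * j < n\<close>. The remaining range becomes \<open>k = 1..3 * i\<close> under
    \<open>j = i + k - 1\<close>.\<close>
  also have "\<dots> = (\<Sum>j=i..4 * i - 1. of_int (mm n j) * Y ^ j)"
    using assms(2,3,4) by (intro sum.mono_neutral_right) (auto simp: mm_eq_0')
  also have "\<dots> = (\<Sum>k=1..3 * i. of_int (mm n (i + k - 1)) * Y ^ (i + k - 1))"
  proof -
    have "i = 1 + (i - 1)" "4 * i - 1 = 3 * i + (i - 1)" and k: "k + (i - 1) = i + k - 1" for k
      using assms(3) by simp_all
    then have "{i..4 * i - 1} = {1 + (i - 1)..3 * i + (i - 1)}" by (simp only:)
    then show ?thesis unfolding k[symmetric] by (simp only: sum.shift_bounds_cl_nat_ivl)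
  qed
  also have "\<dots> = fps_X ^ i * G ^ n * ?T"
    unfolding sum_distrib_left
  proof (intro sum.cong refl)
    fix k assume k: "k \<in> {1..3 * i}"
    have "i + k - 1 = i + (k - 1)" and e: "4 * (i + (k - 1)) = n + (4 * k - (4 - e))"
      using k assms(2,4) by auto
    moreover have "Y ^ m = fps_X ^ m * G ^ (4 * m)" for m
      by (simp only: Y_def power_mult_distrib power_mult)
    ultimately have "Y ^ (i + k - 1) = fps_X ^ (i + (k - 1)) * G ^ (4 * (i + (k - 1)))"
      by (simp only:)
    then have "Y ^ (i + k - 1) = fps_X ^ i * G ^ n * (fps_X ^ (k - 1) * G ^ (4 * k - (4 - e)))"
      unfolding e by (simp only: power_add ac_simps)
    then show "of_int (mm n (i + k - 1)) * Y ^ (i + k - 1) =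
        fps_X ^ i * G ^ n * (of_int (mm n (i + k - 1)) * (fps_X ^ (k - 1) * G ^ (4 * k - (4 - e))))"
      by (simp only: ac_simps)
  qed
  finally have "fps_X ^ i * G ^ n * S = fps_X ^ i * G ^ n * ?T" .
  moreover have "fps_X ^ i * G ^ n \<noteq> 0" by simp
  ultimately show ?thesis by (rule mult_left_cancel[THEN iffD1, rotated])
qed

lemma zeta_power: "zeta ^ n = fps_X ^ n * G ^ n * tri (G ^ n)"
  by (simp add: zeta_def power_mult_distrib tri_power)

lemma tri_X_power: "tri (fps_X ^ n) = fps_X ^ (3 * n)"
  by (simp add: tri_power tri_X power_mult)

text \<open>Split the power of \<open>q\<close> in \<open>zeta ^ (4 * i - 3)\<close> as
  \<open>3 * (i - 1) + 1 + (i - 1)\<close>. The extra \<open>fps_X\<close> is why residue 2 is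
  extracted here.\<close>

lemma sec_matA:
  assumes "1 \<le> i"
  shows "sec 2 (fps_X ^ (i - 1) * G ^ (4 * i - 3)) =
    (\<Sum>k=1..3 * i. of_int (matA i k) * (fps_X ^ (k - 1) * G ^ (4 * k - 1)))"
proof -
  let ?Z = "fps_X ^ (i - 1) * G ^ (4 * i - 3)"
  have "4 * i - 3 = 3 * (i - 1) + 1 + (i - 1)" using assms by simp
  then have "fps_X ^ (4 * i - 3) = fps_X ^ (3 * (i - 1)) * fps_X * (fps_X ^ (i - 1) :: rat fps)"
    by (metis power_add power_one_right)
  then have "zeta ^ (4 * i - 3) = tri (fps_X ^ (i - 1) * G ^ (4 * i - 3)) * (fps_X * ?Z)"
    unfolding zeta_power tri_mult tri_X_power by (simp only: ac_simps)
  then have "sec 0 (zeta ^ (4 * i - 3)) = fps_X ^ (i - 1) * G ^ (4 * i - 3) * (fps_X * sec 2 ?Z)"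
    by (simp only: sec_tri_mult sec_X_mult)
  also have "\<dots> = fps_X ^ Suc (i - 1) * G ^ (4 * i - 3) * sec 2 ?Z"
    by (simp only: power_Suc ac_simps)
  also have "Suc (i - 1) = i" using assms by simp
  finally show ?thesis
    using assms sec_zeta_power_cancel[of i "4 * i - 3" "sec 2 ?Z" 3] by (simp add: matA_def)
qed

text \<open>Here \<open>4 * i - 1 = 3 * i + (i - 1)\<close> leaves no extra \<open>fps_X\<close>, so
  residue 0 is extracted.\<close>

lemma sec_matB:
  assumes "1 \<le> i"
  shows "sec 0 (fps_X ^ (i - 1) * G ^ (4 * i - 1)) =
    (\<Sum>k=1..3 * i. of_int (matB i k) * (fps_X ^ (k - 1) * G ^ (4 * k - 3)))"
proof -
  let ?Z = "fps_X ^ (i - 1) * G ^ (4 * i - 1)"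
  have "4 * i - 1 = 3 * i + (i - 1)" using assms by simp
  then have "fps_X ^ (4 * i - 1) = fps_X ^ (3 * i) * (fps_X ^ (i - 1) :: rat fps)"
    by (metis power_add)
  then have "zeta ^ (4 * i - 1) = tri (fps_X ^ i * G ^ (4 * i - 1)) * ?Z"
    unfolding zeta_power tri_mult tri_X_power by (simp only: ac_simps)
  then have "fps_X ^ i * G ^ (4 * i - 1) * sec 0 ?Z = sec 0 (zeta ^ (4 * i - 1))"
    by (simp only: sec_tri_mult)
  then show ?thesis
    using assms sec_zeta_power_cancel[of i "4 * i - 1" "sec 0 ?Z" 1] by (simp add: matB_def)
qed

section \<open>The row vectors and their series\<close>

lemma matA_eq_0: "3 * i < k \<Longrightarrow> matA i k = 0"
  and matB_eq_0: "3 * i < k \<Longrightarrow> matB i k = 0"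
  by (cases "i = 0"; simp add: matA_def matB_def mm_eq_0)+

lemma vecmat_0 [simp]: "vecmat x M 0 = 0"
  by (simp add: vecmat_def)

lemma vecmat_eq_sum:
  assumes "\<And>i. x i \<noteq> 0 \<Longrightarrow> 1 \<le> i \<and> i \<le> L" "1 \<le> j"
  shows "vecmat x M j = (\<Sum>i=1..L. x i * M i j)"
proof -
  have "(\<Sum>i | 1 \<le> i \<and> x i \<noteq> 0. x i * M i j) = (\<Sum>i=1..L. x i * M i j)"
    using assms(1) by (intro sum.mono_neutral_left) auto
  then show ?thesis using assms(2) by (simp add: vecmat_def)
qed

lemma vecmat_support:
  assumes "\<And>i. x i \<noteq> 0 \<Longrightarrow> 1 \<le> i \<and> i \<le> L" "\<And>i k. 3 * i < k \<Longrightarrow> M i k = 0"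
    and "vecmat x M j \<noteq> 0"
  shows "1 \<le> j \<and> j \<le> 3 * L"
proof -
  have j: "1 \<le> j" using assms(3) by (cases j) auto
  then have "(\<Sum>i=1..L. x i * M i j) \<noteq> 0"
    using assms(3) vecmat_eq_sum[OF assms(1)] by simp
  then obtain i where "i \<le> L" "M i j \<noteq> 0"
    by (metis (no_types, lifting) atLeastAtMost_iff mult_zero_right sum.neutral)
  with assms(2)[of i j] j show ?thesis by linarith
qed

text \<open>Row \<open>i\<close> of either matrix ends at column \<open>3 * i\<close>, so each step
  at most triples the support bound.\<close>

lemma xv_support: "xv a i \<noteq> 0 \<Longrightarrow> 1 \<le> i \<and> i \<le> 3 ^ a"
proof (induction a arbitrary: i)
  case 0
  then show ?case by (simp split: if_splits)
next
  case (Suc a)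
  show ?case
    using vecmat_support[of "xv a" "3 ^ a" "if even a then matA else matB" i] Suc
    by (auto simp: matA_eq_0 matB_eq_0 split: if_splits)
qed

text \<open>The right-hand sides of the theorem: \<open>e = 3\<close> at even levels,
  \<open>e = 1\<close> at odd ones.\<close>

definition vec_series :: "nat \<Rightarrow> (nat \<Rightarrow> int) \<Rightarrow> rat fps" where
  "vec_series e x = (\<Sum>i | 1 \<le> i \<and> x i \<noteq> 0.
     fps_const (of_int (x i)) * fps_X ^ (i - 1) * G ^ (4 * i - e))"

lemma vec_series_eq_sum:
  assumes "\<And>i. x i \<noteq> 0 \<Longrightarrow> 1 \<le> i \<and> i \<le> L"
  shows "vec_series e x = (\<Sum>i=1..L. fps_const (of_int (x i)) * (fps_X ^ (i - 1) * G ^ (4 * i - e)))"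
  unfolding vec_series_def mult.assoc
  using assms by (intro sum.mono_neutral_left) auto

text \<open>By linearity, extraction acts on the coefficient vector as multiplication by
  \<open>M\<close>. Fixed ranges up to \<open>L\<close> and \<open>3 * L\<close> allow the two sums
  to be exchanged.\<close>

lemma sec_vec_series:
  assumes sec: "\<And>i. 1 \<le> i \<Longrightarrow> sec r (fps_X ^ (i - 1) * G ^ (4 * i - e)) =
      (\<Sum>k=1..3 * i. of_int (M i k) * (fps_X ^ (k - 1) * G ^ (4 * k - e')))"
    and M: "\<And>i k. 3 * i < k \<Longrightarrow> M i k = 0"
    and L: "\<And>i. x i \<noteq> 0 \<Longrightarrow> 1 \<le> i \<and> i \<le> L"
  shows "sec r (vec_series e x) = vec_series e' (vecmat x M)"
proof -
  let ?g = "\<lambda>k. fps_X ^ (k - 1) * G ^ (4 * k - e')"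
  have c: "fps_const (of_int z) = (of_int z :: rat fps)" for z
    by (simp add: fps_of_int)
  have "vec_series e x = (\<Sum>i=1..L. fps_const (of_int (x i)) * (fps_X ^ (i - 1) * G ^ (4 * i - e)))"
    by (rule vec_series_eq_sum) (rule L)
  then have "sec r (vec_series e x) = (\<Sum>i=1..L. fps_const (of_int (x i)) * sec r (fps_X ^ (i - 1) * G ^ (4 * i - e)))"
    by (simp only: sec_sum sec_const_mult)
  also have "\<dots> = (\<Sum>i=1..L. of_int (x i) * (\<Sum>k=1..3 * i. of_int (M i k) * ?g k))"
    by (intro sum.cong refl) (simp only: sec c atLeastAtMost_iff)
  also have "\<dots> = (\<Sum>i=1..L. of_int (x i) * (\<Sum>k=1..3 * L. of_int (M i k) * ?g k))"
    by (intro sum.cong refl arg_cong2[where f = "(*)"] sum.mono_neutral_left) (auto simp: M)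
  also have "\<dots> = (\<Sum>i=1..L. \<Sum>k=1..3 * L. of_int (x i * M i k) * ?g k)"
    by (simp only: sum_distrib_left of_int_mult mult.assoc)
  also have "\<dots> = (\<Sum>k=1..3 * L. of_int (\<Sum>i=1..L. x i * M i k) * ?g k)"
    by (subst sum.swap) (simp only: of_int_sum sum_distrib_right)
  also have "\<dots> = (\<Sum>k=1..3 * L. fps_const (of_int (vecmat x M k)) * ?g k)"
  proof (intro sum.cong refl)
    fix k assume "k \<in> {1..3 * L}"
    then have "vecmat x M k = (\<Sum>i=1..L. x i * M i k)"
      by (intro vecmat_eq_sum L) simp_all
    then show "of_int (\<Sum>i=1..L. x i * M i k) * ?g k = fps_const (of_int (vecmat x M k)) * ?g k"
      by (simp only: c)
  qed
  also have "\<dots> = vec_series e' (vecmat x M)"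
    using vecmat_support[of x L M, OF L M] by (intro vec_series_eq_sum[symmetric]) blast
  finally show ?thesis .
qed

lemma sec_vec_series_xv:
  "sec 2 (vec_series 3 (xv (2 * \<alpha>))) = vec_series 1 (xv (2 * \<alpha> + 1))"
  "sec 0 (vec_series 1 (xv (2 * \<alpha> + 1))) = vec_series 3 (xv (2 * Suc \<alpha>))"
  using sec_vec_series[OF sec_matA matA_eq_0 xv_support[of "2 * \<alpha>"]]
    sec_vec_series[OF sec_matB matB_eq_0 xv_support[of "2 * \<alpha> + 1"]]
  by simp_all

text \<open>With \<open>y = 3 ^ (2 * \<alpha>)\<close>,
  \<open>9 * y - 1 = (y - 1) + 4 * (2 * y)\<close>: residue 2 modulo 3 moves one offset to the
  next.\<close>

lemma div_4_step:
  fixes n :: nat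
  shows "3 ^ (2 * \<alpha>) * (3 * n + 2) + (3 ^ (2 * \<alpha>) - 1) div 4 =
      3 ^ (2 * \<alpha> + 1) * n + (3 ^ (2 * \<alpha> + 2) - 1) div 4"
proof -
  define y :: nat where "y = 3 ^ (2 * \<alpha>)"
  have y: "1 \<le> y" "3 ^ (2 * \<alpha> + 2) = 9 * y" "3 ^ (2 * \<alpha> + 1) = 3 * y"
    by (simp_all add: y_def power_add)
  have "(9 * y - 1) div 4 = ((y - 1) + 4 * (2 * y)) div 4"
    using y(1) by (intro arg_cong2[where f = "(div)"]) auto
  also have "\<dots> = 2 * y + (y - 1) div 4"
    by (rule div_mult_self2) simp
  finally show ?thesis
    unfolding y y_def[symmetric] by (simp add: distrib_left)
qed

text \<open>Both identities are proved in alternation: residue 2 leads from the even level to the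
  odd one, residue 0 from there to the next even level.\<close>

lemma a3_series:
  "Abs_fps (\<lambda>n. a3 (3 ^ (2 * \<alpha>) * n + (3 ^ (2 * \<alpha>) - 1) div 4)) = vec_series 3 (xv (2 * \<alpha>)) \<and>
   Abs_fps (\<lambda>n. a3 (3 ^ (2 * \<alpha> + 1) * n + (3 ^ (2 * \<alpha> + 2) - 1) div 4)) = vec_series 1 (xv (2 * \<alpha> + 1))"
proof (induction \<alpha>)
  have step: "Abs_fps (\<lambda>n. a3 (3 ^ (2 * \<alpha> + 1) * n + (3 ^ (2 * \<alpha> + 2) - 1) div 4)) = vec_series 1 (xv (2 * \<alpha> + 1))"
    if "Abs_fps (\<lambda>n. a3 (3 ^ (2 * \<alpha>) * n + (3 ^ (2 * \<alpha>) - 1) div 4)) = vec_series 3 (xv (2 * \<alpha>))" for \<alpha>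
    unfolding sec_vec_series_xv(1)[symmetric] that[symmetric]
    by (simp only: sec_def fps_nth_Abs_fps div_4_step)
  {
    case 0
    have "{i. 1 \<le> i \<and> xv 0 i \<noteq> 0} = {1}" by auto
    then have "vec_series 3 (xv (2 * 0)) = G" by (simp add: vec_series_def)
    moreover have "Abs_fps (\<lambda>n. a3 (3 ^ (2 * 0) * n + (3 ^ (2 * 0) - 1) div 4)) = G"
      by (simp add: a3_def fps_eq_iff)
    ultimately show ?case using step[of 0] by (simp only:)
  next
    case (Suc \<alpha>)
    \<comment> \<open>Residue 0 leaves the offset unchanged and only multiplies the modulus by
      3.\<close>
    have "3 ^ (2 * Suc \<alpha>) * n + (3 ^ (2 * Suc \<alpha>) - 1) div 4 =
        3 ^ (2 * \<alpha> + 1) * (3 * n + 0) + (3 ^ (2 * \<alpha> + 2) - 1) div (4::nat)" for n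
      by simp
    then have "Abs_fps (\<lambda>n. a3 (3 ^ (2 * Suc \<alpha>) * n + (3 ^ (2 * Suc \<alpha>) - 1) div 4)) = vec_series 3 (xv (2 * Suc \<alpha>))"
      unfolding sec_vec_series_xv(2)[symmetric] Suc[THEN conjunct2, symmetric]
      by (simp only: sec_def fps_nth_Abs_fps)
    then show ?case using step[of "Suc \<alpha>"] by blast
  }
qed

theorem theorem3p1:
  fixes \<alpha> :: nat
  shows "Abs_fps (\<lambda>n. a3 (3 ^ (2 * \<alpha>) * n + (3 ^ (2 * \<alpha>) - 1) div 4)) =
           (\<Sum>i | 1 \<le> i \<and> xv (2 * \<alpha>) i \<noteq> 0.
              fps_const (of_int (xv (2 * \<alpha>) i)) * fps_X ^ (i - 1) * G ^ (4 * i - 3))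
       \<and> Abs_fps (\<lambda>n. a3 (3 ^ (2 * \<alpha> + 1) * n + (3 ^ (2 * \<alpha> + 2) - 1) div 4)) =
           (\<Sum>i | 1 \<le> i \<and> xv (2 * \<alpha> + 1) i \<noteq> 0.
              fps_const (of_int (xv (2 * \<alpha> + 1) i)) * fps_X ^ (i - 1) * G ^ (4 * i - 1))"
  by (rule a3_series[unfolded vec_series_def])

end
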